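(* Let $\operatorname{Aff}=\left\{\begin{pmatrix} e^s & t\\ 0&1\end{pmatrix} : s,t\in\mathbf R\right\}$ be the group of orientation preserving affine transformations of the real line, with its usual Lie group topology. The space $\mathcal C(\operatorname{Aff})$ of closed subgroups of $\operatorname{Aff}$ (with the Chabauty topology) is a compact, contractible space of dimension $2$. More precisely, it is the union of a closed $2$-disc $\mathbf D$ and a compact interval $I$ attached by one of its end points to a point on the boundary circle $\partial\mathbf D$. The disc $\mathbf D$ arises as a cone over the real projective line formed by the subgroups isomorphic to $\mathbf R$; the cone point is the trivial subgroup $\{e\}$. The subspace $\mathcal N(\operatorname{Aff})$ consisting of the closed normal subgroups of $\operatorname{Aff}$ is the disjoint union of the point $\{e\}$ and the closed interval $I$; in particular, $\mathcal N(\operatorname{Aff})$ is disconnected.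
   Context: For a locally compact group $G$, $\mathcal C(G)$ denotes the set of closed subgroups of $G$ with the Chabauty topology: a basis of neighbourhoods of $C\in\mathcal C(G)$ is formed by the sets $\mathcal V_{K,U}(C)=\{D\in\mathcal C(G) : D\cap K\subset CU \text{ and } C\cap K\subset DU\}$, where $K\subseteq G$ is compact and $U$ is an open neighbourhood of the identity $e$. This space is compact. Subsets of $\mathcal C(G)$ carry the induced topology. *)

theory Defs
  imports "HOL-Analysis.Analysis" "HOL-Algebra.Coset"
begin

text \<open>A topological group is a group \<open>G\<close> together with a topology \<open>T\<close> whose \<open>topspace\<close> is
  \<open>carrier G\<close>.\<close>

definition closed_subgroups :: "('a, 'b) monoid_scheme \<Rightarrow> 'a topology \<Rightarrow> 'a set set" where
  "closed_subgroups G T = {H. subgroup H G \<and> closedin T H}"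

definition chabauty_nbhd ::
  "('a, 'b) monoid_scheme \<Rightarrow> 'a topology \<Rightarrow> 'a set \<Rightarrow> 'a set \<Rightarrow> 'a set \<Rightarrow> 'a set set" where
  "chabauty_nbhd G T K U C =
     {D \<in> closed_subgroups G T. D \<inter> K \<subseteq> C <#>\<^bsub>G\<^esub> U \<and> C \<inter> K \<subseteq> D <#>\<^bsub>G\<^esub> U}"

text \<open>The topology for which the sets \<^term>\<open>chabauty_nbhd G T K U C\<close> form a basis of neighbourhoods
  of \<open>C\<close>: a set is open iff it is a neighbourhood of each of its points.\<close>

definition chabauty :: "('a, 'b) monoid_scheme \<Rightarrow> 'a topology \<Rightarrow> 'a set topology" where
  "chabauty G T = topology (\<lambda>W. W \<subseteq> closed_subgroups G T \<and>
     (\<forall>C\<in>W. \<exists>K U. compactin T K \<and> openin T U \<and> \<one>\<^bsub>G\<^esub> \<in> U \<and> chabauty_nbhd G T K U C \<subseteq> W))"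

lemma chabauty_nbhd_mono:
  assumes "K' \<subseteq> K" "U \<subseteq> U'"
  shows "chabauty_nbhd G T K U C \<subseteq> chabauty_nbhd G T K' U' C"
proof -
  have "A <#>\<^bsub>G\<^esub> U \<subseteq> A <#>\<^bsub>G\<^esub> U'" for A
    using assms(2) by (auto simp: set_mult_def)
  then show ?thesis
    using assms(1) unfolding chabauty_nbhd_def by blast
qed

lemma openin_chabauty:
  "openin (chabauty G T) W \<longleftrightarrow> W \<subseteq> closed_subgroups G T \<and>
     (\<forall>C\<in>W. \<exists>K U. compactin T K \<and> openin T U \<and> \<one>\<^bsub>G\<^esub> \<in> U \<and> chabauty_nbhd G T K U C \<subseteq> W)"
proof -
  let ?N = "\<lambda>W C. \<exists>K U. compactin T K \<and> openin T U \<and> \<one>\<^bsub>G\<^esub> \<in> U \<and> chabauty_nbhd G T K U C \<subseteq> W"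
  have int: "?N (V \<inter> W) C" if V: "?N V C" and W: "?N W C" for V W C
  proof -
    obtain K U where 1: "compactin T K" "openin T U" "\<one>\<^bsub>G\<^esub> \<in> U" "chabauty_nbhd G T K U C \<subseteq> V"
      using V by blast
    obtain K' U' where 2: "compactin T K'" "openin T U'" "\<one>\<^bsub>G\<^esub> \<in> U'" "chabauty_nbhd G T K' U' C \<subseteq> W"
      using W by blast
    have "chabauty_nbhd G T (K \<union> K') (U \<inter> U') C \<subseteq> V \<inter> W"
      using chabauty_nbhd_mono[of K "K \<union> K'" "U \<inter> U'" U G T C]
        chabauty_nbhd_mono[of K' "K \<union> K'" "U \<inter> U'" U' G T C] 1(4) 2(4) by blast
    then show ?thesis
      using 1 2 by (meson IntI compactin_Un openin_Int)
  qed
  have mono: "?N W C" if "?N V C" "V \<subseteq> W" for V W C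
    using that by (meson order_trans)
  have "istopology (\<lambda>W. W \<subseteq> closed_subgroups G T \<and> (\<forall>C\<in>W. ?N W C))"
    unfolding istopology_def
  proof (intro conjI allI impI)
    fix S R assume "S \<subseteq> closed_subgroups G T \<and> (\<forall>C\<in>S. ?N S C)"
      and "R \<subseteq> closed_subgroups G T \<and> (\<forall>C\<in>R. ?N R C)"
    then show "S \<inter> R \<subseteq> closed_subgroups G T" and "\<forall>C\<in>S \<inter> R. ?N (S \<inter> R) C"
      using int by auto
  next
    fix F assume F: "\<forall>S\<in>F. S \<subseteq> closed_subgroups G T \<and> (\<forall>C\<in>S. ?N S C)"
    then show "\<Union>F \<subseteq> closed_subgroups G T" by blast
    show "\<forall>C\<in>\<Union>F. ?N (\<Union>F) C"
    proof
      fix C assume "C \<in> \<Union>F"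
      then obtain S where S: "S \<in> F" "C \<in> S" by blast
      then have "?N S C" using F by blast
      then show "?N (\<Union>F) C" using S(1) by (rule mono[OF _ Union_upper])
    qed
  qed
  then show ?thesis
    unfolding chabauty_def by (simp add: topology_inverse')
qed

definition topologically_isomorphic ::
  "('a, 'c) monoid_scheme \<Rightarrow> 'a topology \<Rightarrow> ('b, 'd) monoid_scheme \<Rightarrow> 'b topology \<Rightarrow> bool" where
  "topologically_isomorphic G T H S \<longleftrightarrow> (\<exists>f. f \<in> iso G H \<and> homeomorphic_map T S f)"

definition real_group :: "real monoid" where
  "real_group = \<lparr>carrier = UNIV, mult = (+), one = 0\<rparr>"

definition quotient_topology :: "'a topology \<Rightarrow> ('a \<times> 'a) set \<Rightarrow> 'a set topology" where
  "quotient_topology X r = topology (\<lambda>W. W \<subseteq> topspace X // r \<and> openin X (\<Union>W))"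

lemma openin_quotient_topology:
  assumes "equiv (topspace X) r"
  shows "openin (quotient_topology X r) W \<longleftrightarrow> W \<subseteq> topspace X // r \<and> openin X (\<Union>W)"
proof -
  have "istopology (\<lambda>W. W \<subseteq> topspace X // r \<and> openin X (\<Union>W))"
    unfolding istopology_def
  proof (intro conjI allI impI)
    fix S R assume S: "S \<subseteq> topspace X // r \<and> openin X (\<Union>S)"
      and R: "R \<subseteq> topspace X // r \<and> openin X (\<Union>R)"
    then show "S \<inter> R \<subseteq> topspace X // r" by blast
    have "\<Union>(S \<inter> R) = \<Union>S \<inter> \<Union>R"
      using S R quotient_disj[OF assms] by blast
    then show "openin X (\<Union>(S \<inter> R))"
      using S R by auto
  next
    fix F assume F: "\<forall>S\<in>F. S \<subseteq> topspace X // r \<and> openin X (\<Union>S)"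
    then show "\<Union>F \<subseteq> topspace X // r" by blast
    have "\<Union>(\<Union>F) = \<Union>(Union ` F)" by blast
    then show "openin X (\<Union>(\<Union>F))"
      using F by (metis (mono_tags, lifting) imageE openin_Union)
  qed
  then show ?thesis
    unfolding quotient_topology_def by (simp add: topology_inverse')
qed

text \<open>The cone over \<open>X\<close> is \<open>X \<times> [0,1]\<close> with \<open>X \<times> {1}\<close> collapsed to a point; its base is
  \<open>X \<times> {0}\<close>.\<close>

definition cone_rel :: "'a topology \<Rightarrow> (('a \<times> real) \<times> ('a \<times> real)) set" where
  "cone_rel X = {(p, q). p \<in> topspace X \<times> {0..1} \<and> q \<in> topspace X \<times> {0..1} \<and>
     (p = q \<or> snd p = 1 \<and> snd q = 1)}"

lemma equiv_cone_rel: "equiv (topspace (prod_topology X (top_of_set {0..1}))) (cone_rel X)"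
  by (rule equivI) (auto simp: cone_rel_def refl_on_def sym_def trans_def)

definition cone_space :: "'a topology \<Rightarrow> ('a \<times> real) set topology" where
  "cone_space X = quotient_topology (prod_topology X (top_of_set {0..1})) (cone_rel X)"

definition cone_class :: "'a topology \<Rightarrow> 'a \<Rightarrow> real \<Rightarrow> ('a \<times> real) set" where
  "cone_class X x t = cone_rel X `` {(x, t)}"

definition proportional :: "((real^2) \<times> (real^2)) set" where
  "proportional = {(x, y). x \<noteq> 0 \<and> y \<noteq> 0 \<and> (\<exists>c. y = c *\<^sub>R x)}"

lemma equiv_proportional: "equiv (topspace (top_of_set (- {0}))) proportional"
proof (rule equivI)
  show "refl_on (topspace (top_of_set (- {0}))) proportional"
    by (auto simp: proportional_def refl_on_def intro: exI[of _ 1])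
  have "\<exists>d. x = d *\<^sub>R (c *\<^sub>R x)" if "c \<noteq> 0" for c and x :: "real^2"
    using that by (intro exI[of _ "inverse c"]) simp
  then show "sym proportional"
    unfolding sym_def proportional_def by auto
  show "trans proportional"
    unfolding trans_def proportional_def by auto
qed (auto simp: proportional_def)

definition real_projective_line :: "(real^2) set topology" where
  "real_projective_line = quotient_topology (top_of_set (- {0})) proportional"

definition aff_matrix :: "real \<Rightarrow> real \<Rightarrow> real^2^2" where
  "aff_matrix s t = vector [vector [exp s, t], vector [0, 1]]"

definition Aff :: "(real^2^2) monoid" where
  "Aff = \<lparr>carrier = {aff_matrix s t | s t. True}, mult = (**), one = mat 1\<rparr>"

definition Aff_top :: "(real^2^2) topology" where
  "Aff_top = top_of_set (carrier Aff)"

lemma aff_matrix_mult: "aff_matrix s t ** aff_matrix s' t' = aff_matrix (s + s') (exp s * t' + t)"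
  by (simp add: aff_matrix_def matrix_matrix_mult_def vec_eq_iff forall_2 sum_2 exp_add)

lemma aff_matrix_one: "mat 1 = aff_matrix 0 0"
  by (simp add: aff_matrix_def mat_def vec_eq_iff forall_2)

lemma group_Aff: "group Aff"
proof (rule groupI)
  fix x y assume "x \<in> carrier Aff" "y \<in> carrier Aff"
  then show "x \<otimes>\<^bsub>Aff\<^esub> y \<in> carrier Aff"
    unfolding Aff_def using aff_matrix_mult by fastforce
next
  fix x assume "x \<in> carrier Aff"
  then obtain s t where "x = aff_matrix s t" by (auto simp: Aff_def)
  then have "aff_matrix (- s) (- exp (- s) * t) \<otimes>\<^bsub>Aff\<^esub> x = \<one>\<^bsub>Aff\<^esub>"
    by (simp add: Aff_def aff_matrix_mult aff_matrix_one)
  then show "\<exists>y\<in>carrier Aff. y \<otimes>\<^bsub>Aff\<^esub> x = \<one>\<^bsub>Aff\<^esub>"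
    unfolding Aff_def by auto
qed (auto simp: Aff_def aff_matrix_mult aff_matrix_one matrix_mul_assoc)

definition C_Aff :: "(real^2^2) set topology" where
  "C_Aff = chabauty Aff Aff_top"

definition N_Aff :: "(real^2^2) set set" where
  "N_Aff = {H \<in> closed_subgroups Aff Aff_top. H \<lhd> Aff}"

definition R_subgroups_Aff :: "(real^2^2) set set" where
  "R_subgroups_Aff = {H \<in> closed_subgroups Aff Aff_top.
     topologically_isomorphic (Aff\<lparr>carrier := H\<rparr>) (subtopology Aff_top H) real_group euclideanreal}"

end

theory Submission
  imports Defs
begin

text \<open>In a topological group, the Chabauty topology is generated by the conditions of missing a
  compact set and of meeting an open set, which makes continuity and the Hausdorff property easy
  to check. A closed subgroup \<open>H\<close> of \<open>Aff\<close> meets the translation group trivially, in a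
  proper nontrivial subgroup, or contains it. In the first two cases \<open>H\<close> is a closed subgroup of a
  one-parameter group: if \<open>H\<close> contains an element with dilation factor different from \<open>1\<close>, then
  conjugation by it rescales the group of translations in \<open>H\<close>, which must therefore be trivial or
  everything. In the last case \<open>H\<close> is the preimage of a closed subgroup of the group of dilation
  factors.

  Both families are parametrised by one map \<open>E\<close> on the closed unit disc of the Lie algebra, sending
  \<open>w\<close> to the line through \<open>w\<close> if \<open>norm w = 1\<close> and to its cyclic subgroup with shortest vector of
  length \<open>1 / norm w - 1\<close> otherwise. Its fibres are the pairs \<open>{w, - w}\<close>, so that composing it with
  the square root of a complex number embeds the disc, and its restriction to \<open>[0, 1]\<close>
  parametrises the closed subgroups of the real line. All maps in question have compact domains and
  Hausdorff ranges, so it suffices to check continuity and to determine the fibres. The whole space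
  is then homeomorphic to a star-shaped plane set, and its dimension is at least \<open>2\<close> because a
  totally disconnected closed set cannot separate the plane.\<close>

section \<open>The Chabauty topology of a topological group\<close>

lemma topspace_chabauty [simp]: "topspace (chabauty G T) = closed_subgroups G T"
proof
  show "topspace (chabauty G T) \<subseteq> closed_subgroups G T"
    using openin_topspace[of "chabauty G T"] unfolding openin_chabauty by blast
next
  have "\<exists>K U. compactin T K \<and> openin T U \<and> \<one>\<^bsub>G\<^esub> \<in> U \<and>
      chabauty_nbhd G T K U C \<subseteq> closed_subgroups G T"
    if "C \<in> closed_subgroups G T" for C
  proof (intro exI conjI)
    show "\<one>\<^bsub>G\<^esub> \<in> topspace T"
      using that by (auto simp: closed_subgroups_def subgroup_def dest: closedin_subset)
    show "compactin T {}" "openin T (topspace T)"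
      by simp_all
    show "chabauty_nbhd G T {} (topspace T) C \<subseteq> closed_subgroups G T"
      by (auto simp: chabauty_nbhd_def)
  qed
  then have "openin (chabauty G T) (closed_subgroups G T)"
    unfolding openin_chabauty by blast
  then show "closed_subgroups G T \<subseteq> topspace (chabauty G T)"
    by (rule openin_subset)
qed

locale topological_group = group G for G (structure) +
  fixes T :: "'a topology"
  assumes topspace_eq: "topspace T = carrier G"
    and continuous_mult: "continuous_map (prod_topology T T) T (\<lambda>(x, y). x \<otimes> y)"
    and continuous_inv: "continuous_map T T (m_inv G)"
begin

lemma closed_subgroupD:
  assumes "C \<in> closed_subgroups G T"
  shows "closedin T C" "subgroup C G" "C \<subseteq> carrier G" "\<one> \<in> C"
  using assms by (auto simp: closed_subgroups_def subgroup_def)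

lemma continuous_map_mult:
  assumes "continuous_map X T f" "continuous_map X T g"
  shows "continuous_map X T (\<lambda>x. f x \<otimes> g x)"
  using continuous_map_compose[OF continuous_map_pairedI[OF assms] continuous_mult]
  by (simp add: o_def)

lemma continuous_map_inv:
  assumes "continuous_map X T f"
  shows "continuous_map X T (\<lambda>x. inv f x)"
  using continuous_map_compose[OF assms continuous_inv] by (simp add: o_def)

text \<open>The set is the union of the translates of \<open>U\<close> by elements of
  \<open>C\<close>, and each translate is the preimage of \<open>U\<close> under a continuous left
  translation.\<close>

lemma openin_set_mult:
  assumes "C \<subseteq> carrier G" "openin T U"
  shows "openin T (C <#> U)"
proof -
  have U: "U \<subseteq> carrier G"
    using openin_subset[OF assms(2)] topspace_eq by simp
  have "C <#> U = (\<Union>c\<in>C. {g \<in> topspace T. inv c \<otimes> g \<in> U})"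
  proof (intro equalityI subsetI)
    fix g assume "g \<in> C <#> U"
    then obtain c u where "c \<in> C" "u \<in> U" "g = c \<otimes> u"
      by (auto simp: set_mult_def)
    moreover have "inv c \<otimes> (c \<otimes> u) = u" "c \<otimes> u \<in> carrier G"
      using assms(1) U calculation by (auto simp: subsetD m_assoc[symmetric])
    ultimately show "g \<in> (\<Union>c\<in>C. {g \<in> topspace T. inv c \<otimes> g \<in> U})"
      by (force simp: topspace_eq)
  next
    fix g assume "g \<in> (\<Union>c\<in>C. {g \<in> topspace T. inv c \<otimes> g \<in> U})"
    then obtain c where c: "c \<in> C" "g \<in> carrier G" "inv c \<otimes> g \<in> U"
      by (auto simp: topspace_eq)
    then have "g = c \<otimes> (inv c \<otimes> g)"
      using assms(1) by (simp add: subsetD m_assoc[symmetric])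
    then show "g \<in> C <#> U"
      using c unfolding set_mult_def by blast
  qed
  moreover have "openin T {g \<in> topspace T. inv c \<otimes> g \<in> U}" if "c \<in> C" for c
  proof (rule openin_continuous_map_preimage[OF continuous_map_mult assms(2)])
    show "continuous_map T T (\<lambda>x. inv c)"
      using that assms(1) topspace_eq by auto
  qed auto
  ultimately show ?thesis
    by auto
qed

text \<open>Since \<open>C\<close> is closed and misses the compact set \<open>K\<close>, the tube
  lemma yields a neighbourhood \<open>U\<close> of the identity such that
  \<open>g \<otimes> inv u\<close> stays outside \<open>C\<close> for \<open>g\<close> in
  \<open>K\<close> and \<open>u\<close> in \<open>U\<close>. Then \<open>C <#> U\<close> misses
  \<open>K\<close>, and so does every \<open>D\<close> with
  \<open>D \<inter> K \<subseteq> C <#> U\<close>.\<close>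

lemma openin_chabauty_miss:
  assumes K: "compactin T K"
  shows "openin (chabauty G T) {D \<in> closed_subgroups G T. D \<inter> K = {}}"
  unfolding openin_chabauty
proof (intro conjI ballI)
  fix C assume "C \<in> {D \<in> closed_subgroups G T. D \<inter> K = {}}"
  then have C: "C \<in> closed_subgroups G T" "C \<inter> K = {}" by auto
  have KT: "K \<subseteq> carrier G"
    using compactin_subset_topspace[OF K] topspace_eq by simp
  let ?W = "{p \<in> topspace (prod_topology T T). fst p \<otimes> inv (snd p) \<in> topspace T - C}"
  have "openin (prod_topology T T) ?W"
    by (intro openin_continuous_map_preimage[where Y = T] continuous_map_mult continuous_map_inv
        continuous_map_fst continuous_map_snd openin_diff openin_topspace closed_subgroupD(1)[OF C(1)])
  moreover have "K \<times> {\<one>} \<subseteq> ?W"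
    using KT C(2) by (auto simp: topspace_eq subsetD)
  ultimately obtain A U where U: "openin T U" "\<one> \<in> U" "K \<subseteq> A" "A \<times> U \<subseteq> ?W"
    using tube_lemma_left[OF _ K, of T ?W \<one>] by (auto simp: topspace_eq)
  have "(C <#> U) \<inter> K = {}"
  proof safe
    fix g assume "g \<in> C <#> U" "g \<in> K"
    then obtain c u where cu: "c \<in> C" "u \<in> U" "g = c \<otimes> u"
      by (auto simp: set_mult_def)
    have "u \<in> carrier G" "c \<in> carrier G"
      using cu openin_subset[OF U(1)] topspace_eq closed_subgroupD[OF C(1)] by auto
    then have "g \<otimes> inv u = c"
      using cu by (simp add: m_assoc)
    moreover have "(g, u) \<in> ?W"
      using U \<open>g \<in> K\<close> cu(2) by blast
    then have "g \<otimes> inv u \<notin> C"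
      by simp
    ultimately show "g \<in> {}" using cu by simp
  qed
  then have "chabauty_nbhd G T K U C \<subseteq> {D \<in> closed_subgroups G T. D \<inter> K = {}}"
    unfolding chabauty_nbhd_def by blast
  then show "\<exists>K' U. compactin T K' \<and> openin T U \<and> \<one> \<in> U \<and>
      chabauty_nbhd G T K' U C \<subseteq> {D \<in> closed_subgroups G T. D \<inter> K = {}}"
    using K U by blast
qed auto

text \<open>For \<open>c\<close> in \<open>C \<inter> V\<close> the compact set \<open>{c}\<close>
  suffices: a nearby \<open>D\<close> satisfies \<open>c = d \<otimes> u\<close> with
  \<open>u\<close> small, so \<open>d = c \<otimes> inv u\<close> is still in
  \<open>V\<close>.\<close>

lemma openin_chabauty_hit:
  assumes V: "openin T V"
  shows "openin (chabauty G T) {D \<in> closed_subgroups G T. D \<inter> V \<noteq> {}}"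
  unfolding openin_chabauty
proof (intro conjI ballI)
  fix C assume "C \<in> {D \<in> closed_subgroups G T. D \<inter> V \<noteq> {}}"
  then obtain c where C: "C \<in> closed_subgroups G T" and c: "c \<in> C" "c \<in> V" by auto
  have cG: "c \<in> carrier G"
    using C c closed_subgroupD by blast
  let ?U = "{u \<in> topspace T. c \<otimes> inv u \<in> V}"
  have U: "openin T ?U"
    by (intro openin_continuous_map_preimage[OF _ V] continuous_map_mult continuous_map_inv)
      (auto simp: topspace_eq cG)
  have "chabauty_nbhd G T {c} ?U C \<subseteq> {D \<in> closed_subgroups G T. D \<inter> V \<noteq> {}}"
  proof
    fix D assume D: "D \<in> chabauty_nbhd G T {c} ?U C"
    then have "c \<in> D <#> ?U"
      using c by (auto simp: chabauty_nbhd_def)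
    then obtain d u where du: "d \<in> D" "u \<in> ?U" "c = d \<otimes> u"
      by (auto simp: set_mult_def)
    have Dc: "D \<in> closed_subgroups G T"
      using D by (simp add: chabauty_nbhd_def)
    then have "c \<otimes> inv u = d"
      using du closed_subgroupD(3)[OF Dc] by (auto simp: topspace_eq m_assoc subsetD)
    then show "D \<in> {D \<in> closed_subgroups G T. D \<inter> V \<noteq> {}}"
      using du Dc by auto
  qed
  moreover have "compactin T {c}" "\<one> \<in> ?U"
    using cG c by (auto simp: topspace_eq)
  ultimately show "\<exists>K U. compactin T K \<and> openin T U \<and> \<one> \<in> U \<and>
      chabauty_nbhd G T K U C \<subseteq> {D \<in> closed_subgroups G T. D \<inter> V \<noteq> {}}"
    using U by blast
qed auto

text \<open>A point \<open>c\<close> of \<open>C\<close> outside \<open>D\<close> has a compact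
  neighbourhood outside \<open>D\<close>. Meeting its open part and missing the whole of it are
  disjoint open conditions that hold for \<open>C\<close> and \<open>D\<close> respectively.\<close>

lemma Hausdorff_chabauty:
  assumes "locally_compact_space T" "Hausdorff_space T"
  shows "Hausdorff_space (chabauty G T)"
proof -
  have sep: "\<exists>U V. openin (chabauty G T) U \<and> openin (chabauty G T) V \<and> C \<in> U \<and> D \<in> V \<and> disjnt U V"
    if C: "C \<in> closed_subgroups G T" and D: "D \<in> closed_subgroups G T" and "\<not> C \<subseteq> D" for C D
  proof -
    obtain c where c: "c \<in> C" "c \<notin> D"
      using \<open>\<not> C \<subseteq> D\<close> by blast
    have "openin T (topspace T - D)" "c \<in> topspace T - D"
      using c C D closed_subgroupD topspace_eq by blast+
    moreover have "neighbourhood_base_of (compactin T) T"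
      using assms locally_compact_space_neighbourhood_base by blast
    ultimately obtain U K where
      UK: "openin T U" "compactin T K" "c \<in> U" "U \<subseteq> K" "K \<subseteq> topspace T - D"
      unfolding neighbourhood_base_of by (elim allE[of _ "topspace T - D"] allE[of _ c]) auto
    show ?thesis
    proof (intro exI conjI)
      show "openin (chabauty G T) {D \<in> closed_subgroups G T. D \<inter> U \<noteq> {}}"
        "openin (chabauty G T) {D \<in> closed_subgroups G T. D \<inter> K = {}}"
        using UK openin_chabauty_hit openin_chabauty_miss by blast+
      show "C \<in> {D \<in> closed_subgroups G T. D \<inter> U \<noteq> {}}" "D \<in> {D \<in> closed_subgroups G T. D \<inter> K = {}}"
        using C D c UK by auto
      show "disjnt {D \<in> closed_subgroups G T. D \<inter> U \<noteq> {}} {D \<in> closed_subgroups G T. D \<inter> K = {}}"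
        using UK unfolding disjnt_def by blast
    qed
  qed
  show ?thesis
    unfolding Hausdorff_space_def
  proof (intro allI impI)
    fix C D assume "C \<in> topspace (chabauty G T) \<and> D \<in> topspace (chabauty G T) \<and> C \<noteq> D"
    then show "\<exists>U V. openin (chabauty G T) U \<and> openin (chabauty G T) V \<and> C \<in> U \<and> D \<in> V \<and> disjnt U V"
      using sep[of C D] sep[of D C] unfolding disjnt_def by simp blast
  qed
qed

text \<open>Every basic neighbourhood of a closed subgroup contains a finite intersection of miss
  and hit conditions around it, so these conditions suffice to test continuity.\<close>

lemma continuous_map_into_chabauty:
  assumes \<phi>: "\<phi> \<in> topspace X \<rightarrow> closed_subgroups G T"
    and miss: "\<And>K. compactin T K \<Longrightarrow> openin X {x \<in> topspace X. \<phi> x \<inter> K = {}}"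
    and hit: "\<And>V. openin T V \<Longrightarrow> openin X {x \<in> topspace X. \<phi> x \<inter> V \<noteq> {}}"
  shows "continuous_map X (chabauty G T) \<phi>"
  unfolding continuous_map_def
proof (intro conjI allI impI)
  show "\<phi> \<in> topspace X \<rightarrow> topspace (chabauty G T)"
    using \<phi> by simp
  fix W assume W: "openin (chabauty G T) W"
  show "openin X {x \<in> topspace X. \<phi> x \<in> W}"
  proof (subst openin_subopen, intro ballI)
    fix x assume "x \<in> {x \<in> topspace X. \<phi> x \<in> W}"
    then have x: "x \<in> topspace X" "\<phi> x \<in> W" by auto
    define C where "C = \<phi> x"
    have C: "C \<in> closed_subgroups G T"
      using x \<phi> by (auto simp: C_def)
    note C' = closed_subgroupD[OF C]
    obtain K U where KU: "compactin T K" "openin T U" "\<one> \<in> U" "chabauty_nbhd G T K U C \<subseteq> W"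
      using W x unfolding openin_chabauty C_def by blast
    have "C \<subseteq> C <#> U"
    proof
      fix c assume c: "c \<in> C"
      then have "c \<otimes> \<one> \<in> C <#> U"
        using KU(3) unfolding set_mult_def by blast
      then show "c \<in> C <#> U"
        using c C'(3) by auto
    qed
    \<comment> \<open>Missing \<open>K'\<close> is the condition
      \<open>D \<inter> K \<subseteq> C <#> U\<close>. The set is compact because
      \<open>C <#> U\<close> is open.\<close>
    define K' where "K' = K \<inter> (topspace T - (C <#> U))"
    have "closedin T (topspace T - (C <#> U))"
      by (intro closedin_diff closedin_topspace openin_set_mult C'(3) KU(2))
    then have K': "compactin T K'"
      unfolding K'_def using KU(1) by (rule compact_Int_closedin[rotated])
    define N1 where "N1 = {y \<in> topspace X. \<phi> y \<inter> K' = {}}"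
    have N1: "openin X N1" "x \<in> N1"
      using miss[OF K'] x \<open>C \<subseteq> C <#> U\<close> unfolding N1_def K'_def C_def by auto
    have CK: "compactin T (C \<inter> K)"
      using C' KU by (simp add: closed_Int_compactin)
    \<comment> \<open>If \<open>D\<close> contains some \<open>a\<close> in such a \<open>V\<close>,
      then every \<open>b\<close> in \<open>V\<close> lies in \<open>D <#> U\<close>. Finitely many
      such sets cover the compact set \<open>C \<inter> K\<close>, so finitely many hit conditions
      give \<open>C \<inter> K \<subseteq> D <#> U\<close>.\<close>
    have "\<exists>V. openin T V \<and> c \<in> V \<and> (\<forall>a\<in>V. \<forall>b\<in>V. inv a \<otimes> b \<in> U)" if "c \<in> C \<inter> K" for c
    proof -
      have c: "c \<in> carrier G" using that C' by blast
      define P where "P = {p \<in> topspace (prod_topology T T). inv (fst p) \<otimes> snd p \<in> U}"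
      have P: "openin (prod_topology T T) P"
        unfolding P_def by (intro openin_continuous_map_preimage[OF _ KU(2)] continuous_map_mult
            continuous_map_inv continuous_map_fst continuous_map_snd)
      have "(c, c) \<in> P"
        using c KU by (simp add: topspace_eq P_def)
      then obtain V1 V2 where V: "openin T V1" "openin T V2" "c \<in> V1" "c \<in> V2" "V1 \<times> V2 \<subseteq> P"
        using P[unfolded openin_prod_topology_alt] by metis
      then have "inv a \<otimes> b \<in> U" if "a \<in> V1" "b \<in> V2" for a b
        using that by (auto simp: P_def)
      then show ?thesis
        using V by (intro exI[of _ "V1 \<inter> V2"]) auto
    qed
    then obtain V where V: "\<And>c. c \<in> C \<inter> K \<Longrightarrow> openin T (V c) \<and> c \<in> V c"
      "\<And>c a b. \<lbrakk>c \<in> C \<inter> K; a \<in> V c; b \<in> V c\<rbrakk> \<Longrightarrow> inv a \<otimes> b \<in> U"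
      by metis
    obtain F where F: "finite F" "F \<subseteq> C \<inter> K" "C \<inter> K \<subseteq> \<Union>(V ` F)"
      using compactinD[OF CK, of "V ` (C \<inter> K)"] V(1)
      by (smt (verit) UN_I finite_subset_image imageE subsetI)
    \<comment> \<open>The factor \<open>topspace X\<close> matters when \<open>F\<close> is empty,
      since an empty intersection is \<open>UNIV\<close>.\<close>
    define N2 where "N2 = topspace X \<inter> \<Inter>((\<lambda>c. {y \<in> topspace X. \<phi> y \<inter> V c \<noteq> {}}) ` F)"
    have "openin X {y \<in> topspace X. \<phi> y \<inter> V c \<noteq> {}}" if "c \<in> F" for c
      using hit V(1) F(2) that by blast
    then have N2: "openin X N2"
      unfolding N2_def using F(1) by (intro openin_Int_Inter) auto
    have "x \<in> N2"
      using x F V(1) unfolding N2_def C_def by fastforce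
    have "N1 \<inter> N2 \<subseteq> {x \<in> topspace X. \<phi> x \<in> W}"
    proof
      fix y assume y: "y \<in> N1 \<inter> N2"
      then have D: "\<phi> y \<in> closed_subgroups G T" "y \<in> topspace X"
        using \<phi> by (auto simp: N1_def)
      note D' = closed_subgroupD[OF D(1)]
      have "\<phi> y \<inter> K \<subseteq> C <#> U"
        using y D'(3) topspace_eq unfolding N1_def K'_def by auto
      moreover have "C \<inter> K \<subseteq> \<phi> y <#> U"
      proof
        fix b assume b: "b \<in> C \<inter> K"
        then obtain c where c: "c \<in> F" "b \<in> V c"
          using F by blast
        then obtain a where a: "a \<in> \<phi> y" "a \<in> V c"
          using y unfolding N2_def by blast
        have "inv a \<otimes> b \<in> U" "a \<in> carrier G" "b \<in> carrier G"
          using V(2) a b c F D'(3) C'(3) by blast+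
        moreover from this have "b = a \<otimes> (inv a \<otimes> b)"
          by (simp add: m_assoc[symmetric])
        ultimately show "b \<in> \<phi> y <#> U"
          using a unfolding set_mult_def by blast
      qed
      ultimately show "y \<in> {x \<in> topspace X. \<phi> x \<in> W}"
        using KU(4) D by (auto simp: chabauty_nbhd_def)
    qed
    then show "\<exists>N. openin X N \<and> x \<in> N \<and> N \<subseteq> {x \<in> topspace X. \<phi> x \<in> W}"
      using N1 N2 \<open>x \<in> N2\<close> by (meson IntI openin_Int)
  qed
qed

end

section \<open>Quotients and dimension\<close>

text \<open>Identifies an explicit quotient, whose points are classes, with the target of a quotient
  map; it serves for the projective line and for the cone. The induced map is again a quotient map,
  and it is injective because the classes are the fibres of \<open>f\<close>.\<close>

lemma homeomorphic_map_from_quotient_topology: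
  assumes f: "quotient_map X Y f"
    and r: "r = {(x, y). x \<in> topspace X \<and> y \<in> topspace X \<and> f x = f y}"
  obtains h where "homeomorphic_map (quotient_topology X r) Y h"
    and "\<And>x. x \<in> topspace X \<Longrightarrow> h (r `` {x}) = f x"
proof -
  define Q where "Q = quotient_topology X r"
  have eq: "equiv (topspace X) r"
    by (rule equivI) (auto simp: r refl_on_def sym_def trans_def)
  note openQ = openin_quotient_topology[OF eq, folded Q_def]
  \<comment> \<open>Any representative will do, as \<open>f\<close> is constant on each
    class.\<close>
  define h where "h c = f (SOME x. x \<in> c)" for c
  have h: "h (r `` {x}) = f x" if "x \<in> topspace X" for x
  proof -
    have *: "(SOME y. y \<in> r `` {x}) \<in> r `` {x}"
      using that by (intro someI[of "\<lambda>y. y \<in> r `` {x}" x]) (simp add: r)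
    have "f y = f x" if "y \<in> r `` {x}" for y
      using that by (simp add: r)
    then show ?thesis
      unfolding h_def using * by blast
  qed
  have "openin Q (topspace X // r)"
    unfolding openQ by (simp add: Union_quotient[OF eq])
  then have tQ: "topspace Q = topspace X // r"
    using openQ by (metis openin_subset openin_topspace subset_antisym)
  have "quotient_map Q Y h"
    unfolding quotient_map_def
  proof (intro conjI allI impI)
    have "h ` topspace Q = f ` topspace X"
      unfolding tQ quotient_def UNION_singleton_eq_range image_image by (rule image_cong[OF refl h])
    then show "h ` topspace Q = topspace Y"
      using f by (simp add: quotient_imp_surjective_map)
  next
    fix W assume W: "W \<subseteq> topspace Y"
    have "{c \<in> topspace Q. h c \<in> W} = (\<lambda>x. r `` {x}) ` {x \<in> topspace X. f x \<in> W}"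
      unfolding tQ quotient_def by (auto simp: h)
    then have "\<Union>{c \<in> topspace Q. h c \<in> W} = {x \<in> topspace X. f x \<in> W}"
      by (auto simp: r)
    then have "openin Q {c \<in> topspace Q. h c \<in> W} \<longleftrightarrow> openin X {x \<in> topspace X. f x \<in> W}"
      unfolding openQ by (simp add: tQ)
    also have "\<dots> \<longleftrightarrow> openin Y W"
      using f W by (simp add: quotient_map_def)
    finally show "openin Q {c \<in> topspace Q. h c \<in> W} \<longleftrightarrow> openin Y W" .
  qed
  moreover have "inj_on h (topspace Q)"
    unfolding tQ quotient_def by (rule inj_onI) (auto simp: h, auto simp: r)
  ultimately have "homeomorphic_map Q Y h"
    using homeomorphic_map_def by blast
  then show ?thesis
    using that h Q_def by blast
qed

section \<open>Small inductive dimension of plane sets\<close>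

lemma dim_le_0_finite:
  fixes S :: "'a::t1_space set"
  assumes "finite S"
  shows "top_of_set S dim_le 0"
proof -
  have op: "openin (top_of_set S) A" if "A \<subseteq> S" for A
  proof -
    have "closed (S - A)"
      using assms by (simp add: finite_imp_closed)
    then have "openin (top_of_set S) (S \<inter> - (S - A))"
      by blast
    moreover have "S \<inter> - (S - A) = A" using that by blast
    ultimately show ?thesis by simp
  qed
  have fr: "top_of_set S frontier_of A = {}" if "A \<subseteq> S" for A
  proof -
    have "closedin (top_of_set S) A"
      using that op[of "S - A"] by (simp add: closedin_def)
    then show ?thesis
      using op[OF that] clopenin_eq_frontier_of[of "top_of_set S" A] by simp
  qed
  show ?thesis
  proof (rule dimension_le.intros)
    fix V a assume V: "openin (top_of_set S) V" "a \<in> V"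
    then have "subtopology (top_of_set S) (top_of_set S frontier_of V) = trivial_topology"
      using fr openin_subset[OF V(1)] by simp
    then show "\<exists>U. a \<in> U \<and> U \<subseteq> V \<and> openin (top_of_set S) U \<and>
        subtopology (top_of_set S) (top_of_set S frontier_of U) dim_le 0 - 1"
      using V by (intro exI[of _ V]) simp
  qed simp
qed

text \<open>In the coordinate \<open>u = z - a\<close> the first circle gives
  \<open>u * cnj u = r\<^sup>2\<close>. Multiplying the equation of the second circle by
  \<open>u\<close> eliminates \<open>cnj u\<close> and leaves a polynomial equation whose leading
  coefficient \<open>- cnj c\<close> is nonzero.\<close>

lemma finite_sphere_Int_sphere:
  fixes a b :: complex
  assumes "a \<noteq> b"
  shows "finite (sphere a r \<inter> sphere b s)"
proof -
  define c where "c = b - a"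
  define p where "p = [:- c * of_real (r\<^sup>2), of_real (r\<^sup>2) + c * cnj c - of_real (s\<^sup>2), - cnj c:]"
  have "p \<noteq> 0"
    using assms by (simp add: p_def c_def)
  have "poly p (z - a) = 0" if "z \<in> sphere a r \<inter> sphere b s" for z
  proof -
    define u where "u = z - a"
    have "cmod u = r" "cmod (u - c) = s"
      using that by (auto simp: u_def c_def dist_norm norm_minus_commute)
    then have 1: "u * cnj u = of_real (r\<^sup>2)" and 2: "(u - c) * cnj (u - c) = of_real (s\<^sup>2)"
      using complex_norm_square by metis+
    have "(u - c) * (of_real (r\<^sup>2) - u * cnj c) = u * of_real (s\<^sup>2)"
      unfolding 1[symmetric] 2[symmetric] by (simp add: algebra_simps)
    then have "poly p u = 0"
      by (simp add: p_def algebra_simps)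
    then show ?thesis
      by (simp add: u_def)
  qed
  then have "(\<lambda>z. z - a) ` (sphere a r \<inter> sphere b s) \<subseteq> {u. poly p u = 0}"
    by blast
  then have "finite ((\<lambda>z. z - a) ` (sphere a r \<inter> sphere b s))"
    using poly_roots_finite[OF \<open>p \<noteq> 0\<close>] finite_subset by blast
  then show ?thesis
    by (rule finite_imageD) (simp add: inj_on_def)
qed

text \<open>Discs have circles as frontiers. A small disc about a point of a circle cuts out a piece
  whose relative frontier lies on two circles with different centres, hence is finite.\<close>

lemma dim_le_2_complex: "top_of_set (S :: complex set) dim_le 2"
proof -
  have sphere: "top_of_set (sphere a r) dim_le 1" for a :: complex and r
  proof (subst dimension_le_eq_subtopology, intro conjI allI impI)
    fix V and b :: complex assume V: "openin euclidean V \<and> b \<in> V \<and> b \<in> sphere a r"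
    have fr: "top_of_set (sphere a r) frontier_of A \<subseteq> sphere a r" for A
      by (metis frontier_of_subset_topspace topspace_euclidean_subtopology)
    have "\<exists>U. b \<in> U \<and> U \<subseteq> V \<and> open U \<and> finite (top_of_set (sphere a r) frontier_of (sphere a r \<inter> U))"
    \<comment> \<open>A circle of radius 0 consists of its centre alone, so the two centres would
      coincide; but then the circle itself is finite.\<close>
    proof (cases "r = 0")
      case True
      then have "finite (top_of_set (sphere a r) frontier_of (sphere a r \<inter> V))"
        using fr[of "sphere a r \<inter> V"] finite_subset by fastforce
      then show ?thesis
        using V open_openin by blast
    next
      case False
      then have "a \<noteq> b" using V by auto
      obtain e where e: "e > 0" "ball b e \<subseteq> V"
        using V openE by (metis open_openin)
      have "sphere a r \<inter> top_of_set (sphere a r) frontier_of (sphere a r \<inter> ball b e) \<subseteq> sphere b e"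
        using frontier_of_subtopology_subset[of "sphere a r" euclidean "ball b e"] e(1)
          frontier_of_restrict[of "top_of_set (sphere a r)" "ball b e"]
        by simp
      then have "top_of_set (sphere a r) frontier_of (sphere a r \<inter> ball b e) \<subseteq> sphere a r \<inter> sphere b e"
        using fr[of "sphere a r \<inter> ball b e"] by blast
      then have "finite (top_of_set (sphere a r) frontier_of (sphere a r \<inter> ball b e))"
        using finite_sphere_Int_sphere[OF \<open>a \<noteq> b\<close>] finite_subset by blast
      then show ?thesis
        using e by (intro exI[of _ "ball b e"]) auto
    qed
    then show "\<exists>U. b \<in> U \<and> U \<subseteq> V \<and> openin euclidean U \<and>
        top_of_set (top_of_set (sphere a r) frontier_of (sphere a r \<inter> U)) dim_le 1 - 1"
      using dim_le_0_finite by (metis diff_self open_openin)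
  qed simp
  have "(euclidean :: complex topology) dim_le 2"
  proof (rule dimension_le.intros)
    fix V and a :: complex assume V: "openin euclidean V" "a \<in> V"
    then obtain e where "e > 0" "ball a e \<subseteq> V"
      by (metis openE open_openin)
    then show "\<exists>U. a \<in> U \<and> U \<subseteq> V \<and> openin euclidean U \<and>
        top_of_set (euclidean frontier_of U) dim_le 2 - 1"
      using sphere[of a e] by (intro exI[of _ "ball a e"]) simp
  qed simp
  then show ?thesis
    by (rule dimension_le_subtopology)
qed

text \<open>Otherwise 0 has a neighbourhood inside the unit disc with zero-dimensional frontier
  \<open>S\<close>. This frontier separates 0 from 2, so by a separation theorem for closed plane
  sets one of its components does. The components are single points, whose complements are
  connected.\<close>

lemma not_dim_le_1_complex: "\<not> (euclidean :: complex topology) dim_le 1"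
proof
  assume "(euclidean :: complex topology) dim_le 1"
  then obtain U :: "complex set" where U: "0 \<in> U" "U \<subseteq> ball 0 1" "open U"
    and F: "top_of_set (euclidean frontier_of U) dim_le (1 - 1)"
    by (rule dimension_le.cases) (metis centre_in_ball open_ball open_openin zero_less_one)
  define S where "S = frontier U"
  have F: "top_of_set S dim_le 0"
    using F by (simp add: S_def)
  have comp: "\<exists>c. C = {c}" if C: "C \<in> components S" for C
  proof -
    have "C \<noteq> {}" "C \<subseteq> S" "connected C"
      using C in_components_nonempty in_components_subset in_components_connected by blast+
    \<comment> \<open>Zero-dimensionality provides a clopen subset of \<open>S\<close> containing
      \<open>a\<close> but not \<open>b\<close>; it would split the connected set
      \<open>C\<close>.\<close>
    moreover have False if ab: "a \<in> C" "b \<in> C" "a \<noteq> b" for a b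
    proof -
      have "openin (top_of_set S) (S - {b})" "a \<in> S - {b}"
        using ab \<open>C \<subseteq> S\<close> openin_open_Int[of "- {b}" S] by (auto simp: Diff_eq)
      then obtain V where V: "closedin (top_of_set S) V" "openin (top_of_set S) V" "a \<in> V" "V \<subseteq> S - {b}"
        using F unfolding dimension_le_0_neighbourhood_base_of_clopen neighbourhood_base_of
        by (meson subsetD subset_trans)
      have "S \<inter> V = V"
        using V(4) by blast
      then have "openin (top_of_set C) (C \<inter> V)" "closedin (top_of_set C) (C \<inter> V)"
        using openin_subtopology_Int_subset[of S V C] closedin_subtopology_Int_subset[of euclidean S V C]
          V \<open>C \<subseteq> S\<close> by auto
      then have "C \<inter> V = {} \<or> C \<inter> V = C"
        using \<open>connected C\<close> connected_clopen by blast
      then show False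
        using ab V by blast
    qed
    ultimately show ?thesis by blast
  qed
  have "closed S"
    by (simp add: S_def)
  moreover have "\<not> connected_component (- S) 0 2"
  proof
    assume "connected_component (- S) 0 2"
    then obtain T where T: "connected T" "T \<subseteq> - S" "0 \<in> T" "2 \<in> T"
      unfolding connected_component_def by blast
    have "(2::complex) \<notin> U"
      using U(2) by (auto simp: subset_iff)
    then have "T \<inter> frontier U \<noteq> {}"
      using T U(1) by (intro connected_Int_frontier) auto
    then show False
      using T(2) S_def by blast
  qed
  ultimately obtain C where C: "C \<in> components S" "\<not> connected_component (- C) 0 2"
    using separation_by_component_closed_pointwise by blast
  obtain c where c: "C = {c}" "c \<in> S"
    using comp[OF C(1)] C(1) in_components_subset by blast
  have "S \<subseteq> cball 0 1"
    using U(2) closure_mono[OF U(2)] by (auto simp: S_def frontier_def)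
  then have "c \<noteq> 2" "c \<noteq> 0"
    using c U(1,3) by (auto simp: S_def frontier_def interior_open)
  moreover have "connected (- {c})"
    by (simp add: connected_punctured_universe)
  ultimately show False
    using C(2) c(1) unfolding connected_component_def by blast
qed

text \<open>The open disc inside is homeomorphic to the whole plane.\<close>

lemma not_dim_le_1_cball:
  "\<not> top_of_set (cball (0::complex) 1) dim_le 1"
proof
  assume "top_of_set (cball (0::complex) 1) dim_le 1"
  then have "top_of_set (ball (0::complex) 1) dim_le 1"
    by (rule dimension_le_subtopologies) auto
  moreover have "top_of_set (ball (0::complex) 1) homeomorphic_space (euclidean :: complex topology)"
  proof -
    obtain f g where "homeomorphism (ball (0::complex) 1) (UNIV :: complex set) f g"
      using homeomorphic_ball01_UNIV homeomorphic_def by blast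
    then have "homeomorphic_maps (top_of_set (ball 0 1)) euclidean f g"
      by (auto simp: homeomorphism_def homeomorphic_maps_def continuous_map_in_subtopology)
    then show ?thesis
      unfolding homeomorphic_space_def by blast
  qed
  ultimately show False
    using homeomorphic_space_dimension_le not_dim_le_1_complex by blast
qed

section \<open>Closed subgroups of lines through the origin of the plane\<close>

definition additive_subgroup :: "'a::ab_group_add set \<Rightarrow> bool" where
  "additive_subgroup A \<longleftrightarrow> 0 \<in> A \<and> (\<forall>a\<in>A. \<forall>b\<in>A. a - b \<in> A)"

lemma additive_subgroup_uminus: "additive_subgroup A \<Longrightarrow> a \<in> A \<Longrightarrow> - a \<in> A"
  unfolding additive_subgroup_def by (metis diff_0)

lemma additive_subgroup_add:
  assumes "additive_subgroup A" "a \<in> A" "b \<in> A"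
  shows "a + b \<in> A"
proof -
  have "a - (- b) \<in> A"
    using assms additive_subgroup_uminus unfolding additive_subgroup_def by blast
  then show ?thesis by simp
qed

lemma additive_subgroup_int_mult:
  fixes a :: "'a::ring_1"
  assumes A: "additive_subgroup A" "a \<in> A"
  shows "of_int k * a \<in> A"
proof -
  have nat: "of_nat n * a \<in> A" for n
    by (induction n) (use A additive_subgroup_add in \<open>auto simp: additive_subgroup_def algebra_simps\<close>)
  show ?thesis
    using nat[of "nat k"] additive_subgroup_uminus[OF A(1) nat[of "nat (- k)"]]
    by (cases "k \<ge> 0") (auto simp: of_nat_nat)
qed

text \<open>Because \<^term>\<open>\<tau> / 0 = (0::real)\<close>, the second alternative includes \<^term>\<open>A = UNIV\<close>,
  namely for \<^term>\<open>\<mu> = (0::real)\<close>.\<close>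

lemma closed_additive_subgroup_real:
  fixes A :: "real set"
  assumes A: "additive_subgroup A" "closed A"
  shows "A = {0} \<or> (\<exists>\<mu>\<ge>0. A = {\<tau>. \<tau> / \<mu> \<in> \<int>})"
proof (cases "A = {0}")
  case False
  have A0: "0 \<in> A" and Ad: "\<And>a b. a \<in> A \<Longrightarrow> b \<in> A \<Longrightarrow> a - b \<in> A"
    using A(1) by (auto simp: additive_subgroup_def)
  define P where "P = {a \<in> A. a > 0}"
  \<comment> \<open>If this is 0, arbitrarily small positive elements make \<open>A\<close> dense.
    Otherwise it is the least positive element and generates \<open>A\<close>.\<close>
  define \<mu> where "\<mu> = Inf P"
  obtain a where "a \<in> A" "a \<noteq> 0"
    using False A0 by blast
  then have "a \<in> P \<or> - a \<in> P"
    using additive_subgroup_uminus[OF A(1)] by (auto simp: P_def)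
  then have P: "P \<noteq> {}" "bdd_below P"
    by (auto simp: P_def intro!: bdd_belowI[of _ 0])
  have \<mu>_le: "\<mu> \<le> a" if "a \<in> P" for a
    using P(2) that unfolding \<mu>_def by (rule cInf_lower[rotated])
  have "\<mu> \<ge> 0"
    unfolding \<mu>_def by (rule cInf_greatest[OF P(1)]) (simp add: P_def)
  have "A = {\<tau>. \<tau> / \<mu> \<in> \<int>}"
  proof (cases "\<mu> = 0")
    case True
    have "x \<in> A" for x
    proof -
      have "\<exists>y\<in>A. dist y x < e" if "e > 0" for e
      proof -
        obtain a where a: "a \<in> P" "a < e"
          using cInf_lessD[OF P(1), of e] True \<open>e > 0\<close> by (auto simp: \<mu>_def)
        have "of_int \<lfloor>x / a\<rfloor> * a \<in> A"
          using a additive_subgroup_int_mult[OF A(1)] by (simp add: P_def)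
        moreover have "\<bar>of_int \<lfloor>x / a\<rfloor> * a - x\<bar> < a"
        proof -
          have "a > 0" using a by (simp add: P_def)
          then have "of_int \<lfloor>x / a\<rfloor> * a \<le> x" "x < (of_int \<lfloor>x / a\<rfloor> + 1) * a"
            by (simp_all add: pos_le_divide_eq[symmetric] pos_divide_less_eq[symmetric])
          then show ?thesis by (simp add: algebra_simps)
        qed
        ultimately show ?thesis
          using a by (force simp: dist_real_def)
      qed
      then show ?thesis
        using A(2) closed_approachable by blast
    qed
    then show ?thesis
      using True by auto
  next
    case False
    then have "\<mu> > 0" using \<open>\<mu> \<ge> 0\<close> by simp
    have "\<mu> \<in> closure P"
      unfolding \<mu>_def using P by (rule closure_contains_Inf)
    moreover have "closure P \<subseteq> A"
      using A(2) by (intro closure_minimal) (auto simp: P_def)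
    ultimately have \<mu>: "\<mu> \<in> A" by blast
    show ?thesis
    proof (intro equalityI subsetI)
      fix a assume a: "a \<in> A"
      \<comment> \<open>The remainder of \<open>a\<close> modulo \<open>\<mu>\<close> lies in
        \<open>A\<close> and in the half-open interval from 0 to \<open>\<mu>\<close>, so it
        vanishes by minimality.\<close>
      define b where "b = a - of_int \<lfloor>a / \<mu>\<rfloor> * \<mu>"
      have "b \<in> A"
        unfolding b_def using a Ad additive_subgroup_int_mult[OF A(1) \<mu>] by blast
      moreover have "of_int \<lfloor>a / \<mu>\<rfloor> * \<mu> \<le> a" "a < (of_int \<lfloor>a / \<mu>\<rfloor> + 1) * \<mu>"
        using \<open>\<mu> > 0\<close> by (simp_all add: pos_le_divide_eq[symmetric] pos_divide_less_eq[symmetric])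
      then have "0 \<le> b" "b < \<mu>"
        by (simp_all add: b_def algebra_simps)
      ultimately have "b = 0"
        using \<mu>_le[of b] by (force simp: P_def)
      then have "a / \<mu> = of_int \<lfloor>a / \<mu>\<rfloor>"
        using \<open>\<mu> > 0\<close> by (simp add: b_def field_simps)
      then show "a \<in> {\<tau>. \<tau> / \<mu> \<in> \<int>}"
        by (metis Ints_of_int mem_Collect_eq)
    next
      fix a assume "a \<in> {\<tau>. \<tau> / \<mu> \<in> \<int>}"
      then obtain k where "a / \<mu> = of_int k"
        by (auto elim: Ints_cases)
      then have "a = of_int k * \<mu>"
        using \<open>\<mu> > 0\<close> by (simp add: field_simps)
      then show "a \<in> A"
        using additive_subgroup_int_mult[OF A(1) \<mu>] by simp
    qed
  qed
  then show ?thesis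
    using \<open>\<mu> \<ge> 0\<close> by blast
qed simp

text \<open>For \<^term>\<open>0 < norm w \<and> norm w < 1\<close> this is the cyclic group generated by a vector of length
  \<^term>\<open>1 / norm w - 1\<close>. The conventions for division by zero make it the line through
  \<^term>\<open>w\<close> if \<^term>\<open>norm w = 1\<close>, and the trivial group if \<^term>\<open>w = 0\<close>.\<close>

definition radial_step :: "real \<Rightarrow> real" where
  "radial_step r = (1 - r) / r\<^sup>2"

definition radial_subgroup :: "complex \<Rightarrow> complex set" where
  "radial_subgroup w = {of_real \<tau> * w |\<tau>. \<tau> / radial_step (norm w) \<in> \<int>}"

lemma radial_subgroup_0 [simp]: "radial_subgroup 0 = {0}"
  by (auto simp: radial_subgroup_def radial_step_def)

lemma radial_subgroup_unit: "norm w = 1 \<Longrightarrow> radial_subgroup w = range (\<lambda>\<tau>. of_real \<tau> * w)"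
  by (auto simp: radial_subgroup_def radial_step_def)

lemma radial_subgroup_uminus [simp]: "radial_subgroup (- w) = radial_subgroup w"
proof -
  have "\<exists>\<sigma>. - (of_real \<tau> * w) = of_real \<sigma> * w \<and> \<sigma> / m \<in> \<int>" 
    "\<exists>\<sigma>. of_real \<tau> * w = - (of_real \<sigma> * w) \<and> \<sigma> / m \<in> \<int>" if "\<tau> / m \<in> \<int>" for \<tau> m
    using that by (auto intro!: exI[of _ "- \<tau>"])
  then show ?thesis
    unfolding radial_subgroup_def by auto
qed

lemma additive_subgroup_radial: "additive_subgroup (radial_subgroup w)"
  unfolding additive_subgroup_def
proof (intro conjI ballI)
  show "0 \<in> radial_subgroup w"
    by (auto simp: radial_subgroup_def intro!: exI[of _ 0])
  fix a b assume "a \<in> radial_subgroup w" "b \<in> radial_subgroup w"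
  then obtain \<sigma> \<tau> where "a = of_real \<sigma> * w" "b = of_real \<tau> * w"
    "\<sigma> / radial_step (norm w) \<in> \<int>" "\<tau> / radial_step (norm w) \<in> \<int>"
    by (auto simp: radial_subgroup_def)
  then show "a - b \<in> radial_subgroup w"
    unfolding radial_subgroup_def
    by (auto simp: diff_divide_distrib left_diff_distrib intro!: exI[of _ "\<sigma> - \<tau>"])
qed

text \<open>For \<open>norm w < 1\<close> the coefficient of \<open>z\<close> is a nonzero integer
  multiple of the step, hence at least as large in absolute value. The bound
  \<open>norm z \<ge> 1 / norm w - 1\<close> is written without division so that it survives the
  limit \<open>w = 0\<close>.\<close>

lemma radial_subgroup_norm_bound:
  assumes w: "norm w \<le> 1" and z: "z \<in> radial_subgroup w" "z \<noteq> 0"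
  shows "1 - norm w \<le> norm z * norm w"
proof (cases "norm w = 1")
  case False
  define m where "m = radial_step (norm w)"
  obtain \<tau> where \<tau>: "z = of_real \<tau> * w" "\<tau> / m \<in> \<int>"
    using z by (auto simp: radial_subgroup_def m_def)
  have nz: "w \<noteq> 0" "\<tau> \<noteq> 0"
    using z \<tau> by auto
  then have "m > 0"
    using False w by (simp add: m_def radial_step_def)
  then have "\<bar>\<tau> / m\<bar> \<ge> 1"
    using nz \<tau>(2) by (intro Ints_nonzero_abs_ge1) auto
  then have "m \<le> \<bar>\<tau>\<bar>"
    using \<open>m > 0\<close> by (simp add: abs_divide pos_le_divide_eq)
  then have "m * (norm w)\<^sup>2 \<le> \<bar>\<tau>\<bar> * (norm w)\<^sup>2"
    by (rule mult_right_mono) simp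
  also have "m * (norm w)\<^sup>2 = 1 - norm w"
    using nz by (simp add: m_def radial_step_def)
  finally show ?thesis
    by (simp add: \<tau>(1) norm_mult power2_eq_square mult.assoc)
qed simp

text \<open>The generator attains the lower bound on lengths. The slack \<open>e\<close> covers
  \<open>norm w = 1\<close>, where the group is a line and has no shortest nonzero element.\<close>

lemma radial_subgroup_short_element:
  assumes w: "norm w \<le> 1" "w \<noteq> 0" and e: "e > 0"
  obtains z where "z \<in> radial_subgroup w" "z \<noteq> 0" "norm z * norm w \<le> 1 - norm w + e"
proof (cases "norm w = 1")
  case True
  have "of_real e * w \<in> radial_subgroup w"
    using radial_subgroup_unit[OF True] by blast
  then show ?thesis
    using that[of "of_real e * w"] True e w by (auto simp: norm_mult)
next
  case False
  define m where "m = radial_step (norm w)"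
  have "m > 0"
    using False w by (simp add: m_def radial_step_def)
  then have "of_real m * w \<in> radial_subgroup w"
    unfolding radial_subgroup_def m_def by auto
  moreover have "norm (of_real m * w) * norm w = m * (norm w)\<^sup>2"
    using \<open>m > 0\<close> by (simp add: norm_mult power2_eq_square)
  moreover have "m * (norm w)\<^sup>2 = 1 - norm w"
    using w by (simp add: m_def radial_step_def)
  ultimately show ?thesis
    using that[of "of_real m * w"] \<open>m > 0\<close> w e by simp
qed

text \<open>A short element of the smaller group obeys the lower bound on lengths of the larger one;
  comparing both estimates and letting \<open>e\<close> tend to 0 orders the norms.\<close>

lemma radial_subgroup_mono_norm:
  assumes "norm w \<le> 1" "w \<noteq> 0" "norm v \<le> 1" "radial_subgroup w \<subseteq> radial_subgroup v"
  shows "norm w \<le> norm v"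
proof (rule field_le_epsilon)
  fix e :: real assume "e > 0"
  obtain z where z: "z \<in> radial_subgroup w" "z \<noteq> 0" "norm z * norm w \<le> 1 - norm w + e"
    using radial_subgroup_short_element assms(1,2) \<open>e > 0\<close> by blast
  have "(1 - norm v) * norm w \<le> norm z * norm v * norm w"
    using assms z by (intro mult_right_mono radial_subgroup_norm_bound) auto
  also have "\<dots> = norm z * norm w * norm v"
    by simp
  also have "\<dots> \<le> (1 - norm w + e) * norm v"
    using z(3) by (rule mult_right_mono) simp
  finally have "norm w \<le> norm v + e * norm v"
    by (simp add: algebra_simps)
  also have "\<dots> \<le> norm v + e"
    using \<open>e > 0\<close> assms(3) by (simp add: mult_left_le)
  finally show "norm w \<le> norm v + e" .
qed

text \<open>The lengths of the elements determine \<open>norm w\<close>, and a common nonzero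
  element determines the line through \<open>w\<close>. Only the sign remains free.\<close>

lemma radial_subgroup_eq_iff:
  assumes "norm w \<le> 1" "norm v \<le> 1"
  shows "radial_subgroup w = radial_subgroup v \<longleftrightarrow> w = v \<or> w = - v"
proof
  assume eq: "radial_subgroup w = radial_subgroup v"
  have eq0: "u = 0" if "radial_subgroup u = {0}" "norm u \<le> 1" for u
    using that radial_subgroup_short_element[of u 1] by (metis singletonD zero_less_one)
  show "w = v \<or> w = - v"
  proof (cases "w = 0 \<or> v = 0")
    case True
    then show ?thesis
      using eq eq0[of w] eq0[of v] assms by auto
  next
    case False
    then have "norm w = norm v"
      using radial_subgroup_mono_norm[of w v] radial_subgroup_mono_norm[of v w] assms eq by auto
    obtain z where z: "z \<in> radial_subgroup w" "z \<in> radial_subgroup v" "z \<noteq> 0"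
      using radial_subgroup_short_element[of w 1] assms False eq by auto
    then obtain \<sigma> \<tau> where "z = of_real \<sigma> * w" "z = of_real \<tau> * v"
      unfolding radial_subgroup_def by blast
    then have st: "of_real \<sigma> * w = of_real \<tau> * v" "\<sigma> \<noteq> 0"
      using z(3) by auto
    then have "\<bar>\<sigma>\<bar> * norm w = \<bar>\<tau>\<bar> * norm w"
      using \<open>norm w = norm v\<close> by (metis norm_mult norm_of_real)
    then have "\<sigma> = \<tau> \<or> \<sigma> = - \<tau>"
      using False by (simp add: abs_eq_iff)
    then have "of_real \<sigma> * w = of_real \<sigma> * v \<or> of_real \<sigma> * w = of_real \<sigma> * (- v)"
      using st(1) by auto
    then show ?thesis
      using st(2) by (simp only: mult_cancel_left of_real_eq_0_iff) blast
  qed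
qed auto

text \<open>Upper semicontinuity of the parametrisation. For \<open>v \<noteq> 0\<close> the
  coefficients \<open>Re (z n / w n)\<close> converge, and their quotients by the step stay integers
  in the limit because \<open>\<int>\<close> is closed.\<close>

lemma radial_subgroup_limit:
  assumes w: "\<And>n. norm (w n) \<le> 1" and z: "\<And>n. z n \<in> radial_subgroup (w n)"
    and lim: "w \<longlonglongrightarrow> v" "z \<longlonglongrightarrow> y"
  shows "y \<in> radial_subgroup v"
proof (cases "v = 0")
  case True
  have "y = 0"
  proof (rule ccontr)
    \<comment> \<open>As \<open>w n\<close> tends to 0 the nonzero elements escape to infinity: the
      lower bound on lengths would become \<open>1 \<le> 0\<close> in the limit.\<close>
    assume "y \<noteq> 0"
    then have "eventually (\<lambda>n. z n \<noteq> 0) sequentially"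
      using lim(2) by (rule tendsto_imp_eventually_ne[rotated])
    then have "eventually (\<lambda>n. 1 - norm (w n) \<le> norm (z n) * norm (w n)) sequentially"
      by eventually_elim (use radial_subgroup_norm_bound w z in blast)
    moreover have "(\<lambda>n. 1 - norm (w n)) \<longlonglongrightarrow> 1 - norm v"
      "(\<lambda>n. norm (z n) * norm (w n)) \<longlonglongrightarrow> norm y * norm v"
      by (intro tendsto_intros lim)+
    ultimately have "1 - norm v \<le> norm y * norm v"
      using tendsto_le[OF sequentially_bot] by blast
    then show False
      using True by simp
  qed
  then show ?thesis
    using True by simp
next
  case False
  define \<tau> where "\<tau> n = Re (z n / w n)" for n
  define m where "m n = radial_step (norm (w n))" for n
  have \<tau>: "z n = of_real (\<tau> n) * w n \<and> \<tau> n / m n \<in> \<int>" if "w n \<noteq> 0" for n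
    using z[of n] that by (auto simp: radial_subgroup_def \<tau>_def m_def)
  have ev: "eventually (\<lambda>n. w n \<noteq> 0) sequentially"
    using lim(1) False by (rule tendsto_imp_eventually_ne)
  have \<tau>_lim: "\<tau> \<longlonglongrightarrow> Re (y / v)"
    unfolding \<tau>_def using False by (intro tendsto_intros lim)
  have "(\<lambda>n. of_real (\<tau> n) * w n) \<longlonglongrightarrow> of_real (Re (y / v)) * v"
    by (intro tendsto_intros lim \<tau>_lim)
  moreover have "eventually (\<lambda>n. of_real (\<tau> n) * w n = z n) sequentially"
    using ev by eventually_elim (simp add: \<tau>)
  ultimately have "z \<longlonglongrightarrow> of_real (Re (y / v)) * v"
    by (rule Lim_transform_eventually)
  then have y: "y = of_real (Re (y / v)) * v"
    using lim(2) LIMSEQ_unique by blast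
  have "Re (y / v) / radial_step (norm v) \<in> \<int>"
  \<comment> \<open>If the limiting step is 0, the quotient is 0 by convention, so every coefficient
    is admissible.\<close>
  proof (cases "radial_step (norm v) = 0")
    case nz: False
    have "(\<lambda>n. \<tau> n / m n) \<longlonglongrightarrow> Re (y / v) / radial_step (norm v)"
      unfolding m_def using nz False
      by (intro tendsto_intros \<tau>_lim) (auto simp: radial_step_def intro!: tendsto_intros lim)
    moreover have "eventually (\<lambda>n. \<tau> n / m n \<in> \<int>) sequentially"
      using ev by eventually_elim (simp add: \<tau>)
    ultimately show ?thesis
      by (intro Lim_in_closed_set[OF closed_Ints _ sequentially_bot, where f = "\<lambda>n. \<tau> n / m n"])
  qed simp
  then show ?thesis
    using y unfolding radial_subgroup_def by blast
qed

lemma closed_radial_subgroup: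
  assumes "norm w \<le> 1"
  shows "closed (radial_subgroup w)"
  unfolding closed_sequential_limits
  using radial_subgroup_limit[of "\<lambda>_. w"] assms by blast

text \<open>Parameters whose groups meet \<open>K\<close> form a closed set: choose points in
  \<open>K\<close>, pass to a convergent subsequence and apply upper semicontinuity.\<close>

lemma openin_radial_miss:
  assumes "compact K"
  shows "openin (top_of_set (cball 0 1)) {w \<in> cball 0 1. radial_subgroup w \<inter> K = {}}"
proof -
  let ?C = "{w \<in> cball 0 1. radial_subgroup w \<inter> K \<noteq> {}}"
  have "v \<in> ?C" if w: "\<And>n. w n \<in> ?C" and lim: "w \<longlonglongrightarrow> v" for w v
  proof -
    have "\<forall>n. \<exists>z. z \<in> radial_subgroup (w n) \<and> z \<in> K"
      using w by blast
    then obtain z where z: "\<And>n. z n \<in> radial_subgroup (w n)" "\<And>n. z n \<in> K"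
      by metis
    obtain y s where y: "y \<in> K" "strict_mono s" "(z \<circ> s) \<longlonglongrightarrow> y"
      using assms z(2) unfolding compact_def by blast
    have "y \<in> radial_subgroup v"
      by (rule radial_subgroup_limit[of "w \<circ> s" "z \<circ> s"])
        (use w z y LIMSEQ_subseq_LIMSEQ[OF lim] in auto)
    moreover have "v \<in> cball 0 1"
      using closed_sequentially[OF closed_cball _ lim] w by blast
    ultimately show ?thesis
      using y by blast
  qed
  then have "closed ?C"
    unfolding closed_sequential_limits by blast
  then have "openin (top_of_set (cball 0 1)) (cball 0 1 \<inter> - ?C)"
    by (intro openin_open_Int open_Compl)
  moreover have "cball 0 1 \<inter> - ?C = {w \<in> cball 0 1. radial_subgroup w \<inter> K = {}}"
    by blast
  ultimately show ?thesis by simp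
qed

text \<open>Lower semicontinuity: each point of the group at \<open>v\<close> is the limit, as
  \<open>w\<close> tends to \<open>v\<close>, of points \<open>of_real (\<sigma> w) * w\<close> of
  the groups at \<open>w\<close>.\<close>

lemma openin_radial_hit:
  assumes "open V"
  shows "openin (top_of_set (cball 0 1)) {w \<in> cball 0 1. radial_subgroup w \<inter> V \<noteq> {}}"
proof -
  let ?S = "cball (0::complex) 1"
  have "eventually (\<lambda>w. radial_subgroup w \<inter> V \<noteq> {}) (at v within ?S)"
    if v: "v \<in> ?S" and hit: "radial_subgroup v \<inter> V \<noteq> {}" for v
  proof -
    obtain \<tau> where \<tau>: "of_real \<tau> * v \<in> V" "\<tau> / radial_step (norm v) \<in> \<int>"
      using hit by (auto simp: radial_subgroup_def)
    define m where "m w = radial_step (norm w)" for w :: complex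
    have "\<exists>\<sigma>. (\<forall>w\<in>?S. \<sigma> w / m w \<in> \<int>) \<and> ((\<lambda>w. of_real (\<sigma> w) * w) \<longlongrightarrow> of_real \<tau> * v) (at v within ?S)"
    proof (cases "v = 0")
      case True
      \<comment> \<open>The group at 0 contains only 0, which belongs to every other group.\<close>
      then show ?thesis
        by (intro exI[of _ "\<lambda>_. 0"]) auto
    next
      case False
      have m_lim: "(m \<longlongrightarrow> m v) (at v within ?S)"
        unfolding m_def radial_step_def using False by (intro tendsto_intros) auto
      have "\<exists>\<sigma>. (\<forall>w\<in>?S. \<sigma> w / m w \<in> \<int>) \<and> (\<sigma> \<longlongrightarrow> \<tau>) (at v within ?S)"
      proof (cases "m v = 0")
        case nz: False
        \<comment> \<open>The integer factor is kept while the step varies continuously.\<close>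
        obtain k where k: "\<tau> / m v = of_int k"
          using \<tau>(2) by (auto simp: m_def elim: Ints_cases)
        then have "\<tau> = of_int k * m v"
          using nz by (simp add: field_simps)
        then have "((\<lambda>w. of_int k * m w) \<longlongrightarrow> \<tau>) (at v within ?S)"
          by (simp only:) (intro tendsto_intros m_lim)
        moreover have "of_int k * m w / m w \<in> \<int>" for w
          by (cases "m w = 0") auto
        ultimately show ?thesis
          by (intro exI[of _ "\<lambda>w. of_int k * m w"]) blast
      next
        case zero: True
        \<comment> \<open>On the boundary circle the step tends to 0, so rounding
          \<open>\<tau>\<close> down to a multiple of the step makes an error of at most
          \<open>m w\<close>. Where the step is 0 there is no restriction and \<open>\<tau>\<close>
          itself is kept.\<close>
        define \<sigma> where "\<sigma> w = (if m w = 0 then \<tau> else of_int \<lfloor>\<tau> / m w\<rfloor> * m w)" for w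
        have "\<sigma> w / m w \<in> \<int>" for w
          by (auto simp: \<sigma>_def)
        moreover have "\<bar>\<sigma> w - \<tau>\<bar> \<le> m w" if "w \<in> ?S" for w
        proof -
          have m0: "m w \<ge> 0"
            using that by (simp add: m_def radial_step_def)
          show ?thesis
          proof (cases "m w = 0")
            case False
            then have "m w > 0" using m0 by simp
            then have "of_int \<lfloor>\<tau> / m w\<rfloor> * m w \<le> \<tau>" "\<tau> < (of_int \<lfloor>\<tau> / m w\<rfloor> + 1) * m w"
              by (simp_all add: pos_le_divide_eq[symmetric] pos_divide_less_eq[symmetric])
            then show ?thesis
              using False by (simp add: \<sigma>_def algebra_simps)
          qed (simp add: \<sigma>_def)
        qed
        then have "eventually (\<lambda>w. norm (\<sigma> w - \<tau>) \<le> m w) (at v within ?S)"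
          unfolding eventually_at_filter by (intro always_eventually) (simp del: mem_cball)
        then have "((\<lambda>w. \<sigma> w - \<tau>) \<longlongrightarrow> 0) (at v within ?S)"
          by (rule Lim_null_comparison) (use m_lim zero in simp)
        then have "(\<sigma> \<longlongrightarrow> \<tau>) (at v within ?S)"
          by (rule LIM_zero_cancel)
        ultimately show ?thesis
          by (intro exI[of _ \<sigma>]) blast
      qed
      then obtain \<sigma> where \<sigma>: "\<forall>w\<in>?S. \<sigma> w / m w \<in> \<int>" "(\<sigma> \<longlongrightarrow> \<tau>) (at v within ?S)" by blast
      have "((\<lambda>w. of_real (\<sigma> w) * w) \<longlongrightarrow> of_real \<tau> * v) (at v within ?S)"
        by (intro tendsto_intros \<sigma>)
      then show ?thesis
        using \<sigma>(1) by blast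
    qed
    then obtain \<sigma> where \<sigma>: "\<forall>w\<in>?S. \<sigma> w / m w \<in> \<int>"
      "((\<lambda>w. of_real (\<sigma> w) * w) \<longlongrightarrow> of_real \<tau> * v) (at v within ?S)" by blast
    have "eventually (\<lambda>w. of_real (\<sigma> w) * w \<in> V) (at v within ?S)"
      using \<sigma>(2) assms \<tau>(1) by (rule topological_tendstoD)
    moreover have "eventually (\<lambda>w. w \<in> ?S) (at v within ?S)"
      by (simp add: eventually_at_filter)
    ultimately show ?thesis
    proof eventually_elim
      case (elim w)
      then have "of_real (\<sigma> w) * w \<in> radial_subgroup w"
        using \<sigma>(1) unfolding radial_subgroup_def m_def by blast
      then show ?case
        using elim by blast
    qed
  qed
  then have nbhd: "\<exists>U. open U \<and> v \<in> U \<and> (\<forall>w\<in>U. w \<in> ?S \<longrightarrow> radial_subgroup w \<inter> V \<noteq> {})"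
    if "v \<in> ?S" "radial_subgroup v \<inter> V \<noteq> {}" for v
    using that unfolding eventually_at_topological by metis
  show ?thesis
  proof (subst openin_subopen, intro ballI)
    fix v assume "v \<in> {w \<in> ?S. radial_subgroup w \<inter> V \<noteq> {}}"
    then obtain U where "open U" "v \<in> U" "\<forall>w\<in>U. w \<in> ?S \<longrightarrow> radial_subgroup w \<inter> V \<noteq> {}" "v \<in> ?S"
      using nbhd by blast
    then show "\<exists>T. openin (top_of_set ?S) T \<and> v \<in> T \<and> T \<subseteq> {w \<in> ?S. radial_subgroup w \<inter> V \<noteq> {}}"
      by (intro exI[of _ "?S \<inter> U"]) auto
  qed
qed

text \<open>Serves to exclude these groups from the subgroups isomorphic to the real line.\<close>

lemma countable_radial_subgroup:
  assumes "norm w < 1"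
  shows "countable (radial_subgroup w)"
proof -
  define m where "m = radial_step (norm w)"
  have "radial_subgroup w \<subseteq> (\<lambda>k. of_real (of_int k * m) * w) ` UNIV"
  proof
    fix z assume "z \<in> radial_subgroup w"
    then obtain \<tau> k where \<tau>: "z = of_real \<tau> * w" "\<tau> / m = of_int k"
      unfolding radial_subgroup_def m_def by (blast elim: Ints_cases)
    have "m = 0 \<longleftrightarrow> w = 0"
      using assms by (auto simp: m_def radial_step_def)
    then have "z = of_real (of_int k * m) * w"
      using \<tau> by (cases "w = 0") (auto simp: field_simps)
    then show "z \<in> (\<lambda>k. of_real (of_int k * m) * w) ` UNIV" by blast
  qed
  then show ?thesis
    by (rule countable_subset) simp
qed

lemma closed_subgroup_of_line_is_radial:
  assumes A: "additive_subgroup A" "closed A" and v: "v \<noteq> 0"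
  obtains r where "0 \<le> r" "r \<le> 1"
    and "(\<lambda>\<tau>. of_real \<tau> * v) ` A = radial_subgroup (of_real (r / norm v) * v)"
proof -
  consider "A = {0}" | \<mu> where "\<mu> \<ge> 0" "A = {\<tau>. \<tau> / \<mu> \<in> \<int>}"
    using closed_additive_subgroup_real[OF A] by blast
  then show ?thesis
  proof cases
    case 1
    then show ?thesis
      using that[of 0] by simp
  next
    case 2
    \<comment> \<open>The solution of \<open>1 / r - 1 = \<mu> * norm v\<close>, which matches the
      lengths of the shortest vectors; \<open>\<mu> = 0\<close> gives \<open>r = 1\<close>, the
      whole line.\<close>
    define r where "r = 1 / (1 + \<mu> * norm v)"
    define c where "c = r / norm v"
    have "\<mu> * norm v \<ge> 0" using 2 by simp
    then have r: "0 < r" "r \<le> 1"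
      by (simp_all add: r_def)
    then have c: "c > 0" using v by (simp add: c_def)
    have n: "norm (of_real c * v) = r"
      using v r by (simp add: c_def norm_mult norm_divide)
    have "radial_step r = \<mu> * norm v / r"
      using \<open>\<mu> * norm v \<ge> 0\<close> by (simp add: radial_step_def r_def field_simps power2_eq_square)
    then have step: "radial_step r = \<mu> / c"
      using v by (simp add: c_def)
    have "radial_subgroup (of_real c * v) = (\<lambda>\<tau>. of_real \<tau> * v) ` A"
    proof (intro equalityI subsetI)
      fix z assume "z \<in> radial_subgroup (of_real c * v)"
      then obtain \<tau> where "z = of_real \<tau> * (of_real c * v)" "\<tau> / (\<mu> / c) \<in> \<int>"
        unfolding radial_subgroup_def n step by blast
      then show "z \<in> (\<lambda>\<tau>. of_real \<tau> * v) ` A"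
        unfolding 2 by (intro image_eqI[of _ _ "\<tau> * c"]) auto
    next
      fix z assume "z \<in> (\<lambda>\<tau>. of_real \<tau> * v) ` A"
      then obtain \<tau> where "z = of_real \<tau> * v" "\<tau> / \<mu> \<in> \<int>"
        unfolding 2 by blast
      then show "z \<in> radial_subgroup (of_real c * v)"
        unfolding radial_subgroup_def n step using c by (auto intro!: exI[of _ "\<tau> / c"])
    qed
    then show ?thesis
      using that[of r] r by (simp add: c_def)
  qed
qed

section \<open>Exponential coordinates on the affine group\<close>

lemma aff_matrix_nth [simp]:
  "aff_matrix s t $ 1 $ 1 = exp s" "aff_matrix s t $ 1 $ 2 = t"
  "aff_matrix s t $ 2 $ 1 = 0" "aff_matrix s t $ 2 $ 2 = 1"
  by (simp_all add: aff_matrix_def)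

lemma aff_matrix_eq_iff [simp]: "aff_matrix s t = aff_matrix s' t' \<longleftrightarrow> s = s' \<and> t = t'"
  by (metis aff_matrix_nth(1,2) exp_inj_iff)

lemma carrier_Aff: "carrier Aff = range (\<lambda>(s, t). aff_matrix s t)"
  by (auto simp: Aff_def)

lemma aff_matrix_carrier [simp]: "aff_matrix s t \<in> carrier Aff"
  by (auto simp: Aff_def)

lemma mult_Aff [simp]: "x \<otimes>\<^bsub>Aff\<^esub> y = x ** y"
  by (simp add: Aff_def)

lemma one_Aff [simp]: "\<one>\<^bsub>Aff\<^esub> = aff_matrix 0 0"
  by (simp add: Aff_def aff_matrix_one)

lemma topspace_Aff [simp]: "topspace Aff_top = carrier Aff"
  by (simp add: Aff_top_def)

lemma inv_Aff: "inv\<^bsub>Aff\<^esub> (aff_matrix s t) = aff_matrix (- s) (- exp (- s) * t)"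
  using group.inv_equality[OF group_Aff, of "aff_matrix (- s) (- exp (- s) * t)" "aff_matrix s t"]
  by (simp add: aff_matrix_mult)

lemma continuous_on_matrix:
  fixes f :: "'a::topological_space \<Rightarrow> real^'n^'m"
  assumes "\<And>i j. continuous_on S (\<lambda>x. f x $ i $ j)"
  shows "continuous_on S f"
proof -
  have "continuous_on S (\<lambda>x. \<chi> i. \<chi> j. f x $ i $ j)"
    by (intro continuous_on_vec_lambda assms)
  then show ?thesis by simp
qed

lemma continuous_on_aff_matrix:
  assumes "continuous_on S f" "continuous_on S g"
  shows "continuous_on S (\<lambda>x. aff_matrix (f x) (g x))"
proof (rule continuous_on_matrix)
  fix i j :: 2
  show "continuous_on S (\<lambda>x. aff_matrix (f x) (g x) $ i $ j)"
    using exhaust_2[of i] exhaust_2[of j] assms by (elim disjE) (simp_all add: continuous_on_exp)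
qed

lemma topological_group_Aff: "topological_group Aff Aff_top"
proof -
  have "continuous_map (prod_topology Aff_top Aff_top) Aff_top (\<lambda>(x, y). x \<otimes>\<^bsub>Aff\<^esub> y)"
  proof -
    have "continuous_on (carrier Aff \<times> carrier Aff) (\<lambda>p::(real^2^2) \<times> (real^2^2). fst p ** snd p)"
      unfolding matrix_matrix_mult_def by (intro continuous_on_vec_lambda continuous_intros)
    moreover have "x ** y \<in> carrier Aff" if "x \<in> carrier Aff" "y \<in> carrier Aff" for x y
      using monoid.m_closed[OF group.is_monoid[OF group_Aff] that] by simp
    ultimately show ?thesis
      by (auto simp: Aff_top_def continuous_map_in_subtopology case_prod_unfold
          simp flip: subtopology_Times euclidean_product_topology)
  qed
  moreover have "continuous_map Aff_top Aff_top (m_inv Aff)"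
  proof -
    define f where "f x = aff_matrix (- ln (x $ 1 $ 1)) (- x $ 1 $ 2 / x $ 1 $ 1)" for x :: "real^2^2"
    have "continuous_on (carrier Aff) f"
      unfolding f_def by (intro continuous_on_aff_matrix continuous_intros) (auto simp: carrier_Aff)
    moreover have "m_inv Aff x = f x" if "x \<in> carrier Aff" for x
      using that by (auto simp: carrier_Aff inv_Aff f_def exp_minus field_simps)
    ultimately have "continuous_on (carrier Aff) (m_inv Aff)"
      by (simp cong: continuous_on_cong)
    then show ?thesis
      by (auto simp: Aff_top_def continuous_map_in_subtopology group.inv_closed[OF group_Aff])
  qed
  ultimately show ?thesis
    using group_Aff unfolding topological_group_def topological_group_axioms_def by simp
qed

interpretation Aff: topological_group Aff Aff_top
  by (rule topological_group_Aff)

text \<open>The factor by which the matrix exponential multiplies the upper right entry of a Lie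
  algebra element with dilation part \<open>a\<close>; the value at 0 is the limit.\<close>

definition exp_quotient :: "real \<Rightarrow> real" where
  "exp_quotient a = (if a = 0 then 1 else (exp a - 1) / a)"

lemma exp_quotient_mult: "a * exp_quotient a = exp a - 1"
  by (simp add: exp_quotient_def)

lemma exp_quotient_pos: "exp_quotient a > 0"
  by (auto simp: exp_quotient_def zero_less_divide_iff)

lemma exp_quotient_nonzero: "exp_quotient a \<noteq> 0"
  using exp_quotient_pos[of a] by simp

lemma continuous_on_exp_quotient [continuous_intros]:
  assumes "continuous_on S f"
  shows "continuous_on S (\<lambda>x. exp_quotient (f x))"
proof -
  have "isCont exp_quotient a" for a
  proof (cases "a = 0")
    case True
    \<comment> \<open>The limit at 0 is the derivative of \<open>exp\<close> there.\<close>
    have "(\<lambda>h. (exp (0 + h) - exp (0::real)) / h) \<midarrow>0\<rightarrow> 1"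
      using DERIV_exp[of "0::real"] unfolding DERIV_def exp_zero .
    then have "exp_quotient \<midarrow>0\<rightarrow> 1"
      by (rule Lim_transform_eventually) (simp add: eventually_at_filter exp_quotient_def)
    then show ?thesis
      using True by (simp add: isCont_def exp_quotient_def)
  next
    case False
    have "isCont (\<lambda>a. (exp a - 1) / a) a"
      using False by (intro continuous_intros)
    moreover have "eventually (\<lambda>x. exp_quotient x = (exp x - 1) / x) (nhds a)"
      using t1_space_nhds[OF False] by eventually_elim (simp add: exp_quotient_def)
    ultimately show ?thesis
      by (simp cong: isCont_cong)
  qed
  then have "continuous_on UNIV exp_quotient"
    by (simp add: continuous_at_imp_continuous_on)
  then show ?thesis
    using assms by (rule continuous_on_compose2) simp
qed

text \<open>The exponential map of the Lie algebra of matrices with rows \<open>(a, b)\<close> and \<open>(0, 0)\<close>,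
  encoded as the complex number \<open>a + ib\<close>.\<close>

definition aff_exp :: "complex \<Rightarrow> real^2^2" where
  "aff_exp z = aff_matrix (Re z) (Im z * exp_quotient (Re z))"

definition aff_log :: "real^2^2 \<Rightarrow> complex" where
  "aff_log x = Complex (ln (x $ 1 $ 1)) (x $ 1 $ 2 / exp_quotient (ln (x $ 1 $ 1)))"

lemma aff_log_exp [simp]: "aff_log (aff_exp z) = z"
  using exp_quotient_pos[of "Re z"] by (simp add: aff_log_def aff_exp_def)

lemma aff_exp_log: "x \<in> carrier Aff \<Longrightarrow> aff_exp (aff_log x) = x"
  using exp_quotient_pos by (auto simp: aff_log_def aff_exp_def carrier_Aff less_imp_neq[symmetric])

lemma aff_exp_carrier [simp]: "aff_exp z \<in> carrier Aff"
  by (simp add: aff_exp_def)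

lemma inj_aff_exp: "inj aff_exp"
  by (metis aff_log_exp injI)

lemma aff_exp_eq_iff [simp]: "aff_exp z = aff_exp z' \<longleftrightarrow> z = z'"
  using inj_aff_exp by (simp add: inj_eq)

lemma aff_exp_0 [simp]: "aff_exp 0 = aff_matrix 0 0"
  by (simp add: aff_exp_def)

lemma aff_exp_Re_0: "Re z = 0 \<Longrightarrow> aff_exp z = aff_matrix 0 (Im z)"
  by (simp add: aff_exp_def exp_quotient_def)

lemma continuous_on_aff_exp: "continuous_on S aff_exp"
  unfolding aff_exp_def by (intro continuous_on_aff_matrix continuous_intros)

lemma continuous_on_aff_log: "continuous_on (carrier Aff) aff_log"
proof -
  have "continuous_on (carrier Aff)
      (\<lambda>x. of_real (ln (x $ 1 $ 1)) + \<i> * of_real (x $ 1 $ 2 / exp_quotient (ln (x $ 1 $ 1))))"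
    by (intro continuous_intros) (auto simp: carrier_Aff exp_quotient_nonzero)
  then show ?thesis
    by (simp add: aff_log_def Complex_eq)
qed

text \<open>The exponential map is a global chart, so open, closed and compact subsets of the group
  can be treated in the complex plane.\<close>

lemma homeomorphic_maps_aff_exp: "homeomorphic_maps euclidean Aff_top aff_exp aff_log"
  using continuous_on_aff_exp continuous_on_aff_log
  by (auto simp: homeomorphic_maps_def Aff_top_def continuous_map_in_subtopology aff_exp_log)

lemma Hausdorff_C_Aff: "Hausdorff_space C_Aff"
proof -
  have hom: "(euclidean :: complex topology) homeomorphic_space Aff_top"
    using homeomorphic_maps_aff_exp homeomorphic_space_def by blast
  have "locally_compact_space (euclidean :: complex topology)"
    by (simp add: locally_compact_space_euclidean)
  then have "locally_compact_space Aff_top" "Hausdorff_space Aff_top"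
    using homeomorphic_locally_compact_space[OF hom] homeomorphic_Hausdorff_space[OF hom] by auto
  then show ?thesis
    unfolding C_Aff_def by (rule Aff.Hausdorff_chabauty)
qed

lemma topspace_C_Aff [simp]: "topspace C_Aff = closed_subgroups Aff Aff_top"
  by (simp add: C_Aff_def)

lemma closedin_aff_exp_image: "closedin Aff_top (aff_exp ` S) \<longleftrightarrow> closed S"
proof -
  have "homeomorphic_map euclidean Aff_top aff_exp"
    using homeomorphic_maps_aff_exp homeomorphic_map_maps by blast
  then show ?thesis
    using homeomorphic_map_closedness_eq[of euclidean Aff_top aff_exp S] by auto
qed

lemma open_aff_exp_vimage: "openin Aff_top V \<Longrightarrow> open (aff_exp -` V)"
  using openin_continuous_map_preimage[of euclidean Aff_top aff_exp V] homeomorphic_maps_aff_exp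
  by (simp add: homeomorphic_maps_def vimage_def)

lemma compact_aff_exp_vimage:
  assumes "compactin Aff_top K"
  shows "compact (aff_exp -` K)"
proof -
  have "K \<subseteq> carrier Aff"
    using compactin_subset_topspace[OF assms] by simp
  then have "aff_exp -` K = aff_log ` K"
    using aff_exp_log by force
  then show ?thesis
    using image_compactin[OF assms, of euclidean aff_log] homeomorphic_maps_aff_exp
    by (simp add: homeomorphic_maps_def)
qed

text \<open>Multiples of one vector commute in the Lie algebra, so the exponential map is additive
  along a line through 0.\<close>

lemma aff_exp_mult_collinear:
  "aff_exp (of_real \<sigma> * w) ** aff_exp (of_real \<tau> * w) = aff_exp (of_real (\<sigma> + \<tau>) * w)"
proof (cases "Re w = 0")
  case True
  then show ?thesis
    by (simp add: aff_exp_Re_0 aff_matrix_mult algebra_simps)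
next
  case False
  \<comment> \<open>With \<open>b = Im w / Re w\<close> and \<open>s = \<tau> * Re w\<close> this is
    the map sending \<open>x\<close> to \<open>exp s * (x + b) - b\<close>, a dilation about the
    fixed point \<open>- b\<close>.\<close>
  have eq: "aff_exp (of_real \<tau> * w) = aff_matrix (\<tau> * Re w) (Im w / Re w * (exp (\<tau> * Re w) - 1))" for \<tau>
    using False unfolding exp_quotient_mult[symmetric] by (simp add: aff_exp_def)
  show ?thesis
    unfolding eq by (simp add: aff_matrix_mult exp_add algebra_simps)
qed

lemma subgroup_aff_exp_line:
  assumes "additive_subgroup A"
  shows "subgroup (aff_exp ` (\<lambda>\<tau>. of_real \<tau> * w) ` A) Aff"
proof (rule group.subgroupI[OF group_Aff])
  show "aff_exp ` (\<lambda>\<tau>. of_real \<tau> * w) ` A \<noteq> {}"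
    using assms by (auto simp: additive_subgroup_def)
next
  fix a assume "a \<in> aff_exp ` (\<lambda>\<tau>. of_real \<tau> * w) ` A"
  then obtain \<tau> where \<tau>: "\<tau> \<in> A" "a = aff_exp (of_real \<tau> * w)" by blast
  have "inv\<^bsub>Aff\<^esub> a = aff_exp (of_real (- \<tau>) * w)"
    using aff_exp_mult_collinear[of "- \<tau>" w \<tau>] \<tau> by (intro group.inv_equality[OF group_Aff]) simp_all
  then show "inv\<^bsub>Aff\<^esub> a \<in> aff_exp ` (\<lambda>\<tau>. of_real \<tau> * w) ` A"
    using additive_subgroup_uminus[OF assms \<tau>(1)] by blast
next
  fix a b assume "a \<in> aff_exp ` (\<lambda>\<tau>. of_real \<tau> * w) ` A" "b \<in> aff_exp ` (\<lambda>\<tau>. of_real \<tau> * w) ` A"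
  then obtain \<sigma> \<tau> where "\<sigma> \<in> A" "\<tau> \<in> A" "a = aff_exp (of_real \<sigma> * w)" "b = aff_exp (of_real \<tau> * w)"
    by blast
  then show "a \<otimes>\<^bsub>Aff\<^esub> b \<in> aff_exp ` (\<lambda>\<tau>. of_real \<tau> * w) ` A"
    using additive_subgroup_add[OF assms] unfolding mult_Aff by (auto simp only: aff_exp_mult_collinear)
qed auto

section \<open>The two families of closed subgroups and their continuity\<close>

definition line_group :: "complex \<Rightarrow> (real^2^2) set" where
  "line_group w = aff_exp ` radial_subgroup w"

text \<open>The preimage, under the logarithm of the dilation factor, of the closed subgroup of the
  real line with parameter \<open>r\<close>. The value \<open>r = 0\<close> gives the translations,
  \<open>r = 1\<close> the whole group.\<close>

definition full_group :: "real \<Rightarrow> (real^2^2) set" where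
  "full_group r = {aff_matrix s t |s t. of_real s \<in> radial_subgroup (of_real r)}"

lemma additive_subgroup_Ints_divide: "additive_subgroup {\<tau>::real. \<tau> / m \<in> \<int>}"
  by (auto simp: additive_subgroup_def diff_divide_distrib)

lemma line_group_closed_subgroup:
  assumes "norm w \<le> 1"
  shows "line_group w \<in> closed_subgroups Aff Aff_top"
proof -
  have "radial_subgroup w = (\<lambda>\<tau>. of_real \<tau> * w) ` {\<tau>. \<tau> / radial_step (norm w) \<in> \<int>}"
    by (auto simp: radial_subgroup_def)
  then have "subgroup (line_group w) Aff"
    unfolding line_group_def using subgroup_aff_exp_line[OF additive_subgroup_Ints_divide] by simp
  then show ?thesis
    using closed_radial_subgroup[OF assms]
    by (simp add: closed_subgroups_def closedin_aff_exp_image line_group_def)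
qed

text \<open>The logarithm of the dilation factor of \<open>aff_exp z\<close> is \<open>Re z\<close>,
  so in the chart these groups are unions of vertical lines.\<close>

lemma full_group_eq_image:
  "full_group r = aff_exp ` {z. of_real (Re z) \<in> radial_subgroup (of_real r)}"
proof (intro equalityI subsetI)
  fix x assume "x \<in> full_group r"
  then obtain s t where st: "x = aff_matrix s t" "of_real s \<in> radial_subgroup (of_real r)"
    by (auto simp: full_group_def)
  then have "x = aff_exp (aff_log x)" "Re (aff_log x) = s"
    using aff_exp_log[of x] by (auto simp: aff_log_def)
  then show "x \<in> aff_exp ` {z. of_real (Re z) \<in> radial_subgroup (of_real r)}"
    using st by blast
qed (auto simp: aff_exp_def full_group_def)

lemma full_group_closed_subgroup:
  assumes "0 \<le> r" "r \<le> 1"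
  shows "full_group r \<in> closed_subgroups Aff Aff_top"
proof -
  note E = additive_subgroup_radial[of "of_real r"]
  have "subgroup (full_group r) Aff"
  proof (rule group.subgroupI[OF group_Aff])
    have "complex_of_real 0 \<in> radial_subgroup (of_real r)"
      using E by (simp add: additive_subgroup_def)
    then show "full_group r \<noteq> {}"
      unfolding full_group_def by blast
  next
    fix a assume "a \<in> full_group r"
    then show "inv\<^bsub>Aff\<^esub> a \<in> full_group r"
      using additive_subgroup_uminus[OF E] by (auto simp: full_group_def inv_Aff)
  next
    fix a b assume "a \<in> full_group r" "b \<in> full_group r"
    then show "a \<otimes>\<^bsub>Aff\<^esub> b \<in> full_group r"
      using additive_subgroup_add[OF E] by (auto simp: full_group_def aff_matrix_mult)
  qed (auto simp: full_group_def)
  moreover have "closed ((\<lambda>z. of_real (Re z)) -` radial_subgroup (of_real r))"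
    using assms by (intro closed_vimage closed_radial_subgroup continuous_intros) auto
  ultimately show ?thesis
    unfolding closed_subgroups_def full_group_eq_image by (simp add: closedin_aff_exp_image vimage_def)
qed

lemma continuous_map_line_group: "continuous_map (top_of_set (cball 0 1)) C_Aff line_group"
  unfolding C_Aff_def
proof (rule Aff.continuous_map_into_chabauty)
  show "line_group \<in> topspace (top_of_set (cball 0 1)) \<rightarrow> closed_subgroups Aff Aff_top"
    using line_group_closed_subgroup by auto
next
  fix K assume "compactin Aff_top K"
  moreover have "line_group w \<inter> K = {} \<longleftrightarrow> radial_subgroup w \<inter> aff_exp -` K = {}" for w
    by (auto simp: line_group_def)
  ultimately show "openin (top_of_set (cball 0 1))
      {w \<in> topspace (top_of_set (cball 0 1)). line_group w \<inter> K = {}}"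
    using openin_radial_miss[OF compact_aff_exp_vimage] by simp
next
  fix V assume "openin Aff_top V"
  moreover have "line_group w \<inter> V \<noteq> {} \<longleftrightarrow> radial_subgroup w \<inter> aff_exp -` V \<noteq> {}" for w
    by (auto simp: line_group_def)
  ultimately show "openin (top_of_set (cball 0 1))
      {w \<in> topspace (top_of_set (cball 0 1)). line_group w \<inter> V \<noteq> {}}"
    using openin_radial_hit[OF open_aff_exp_vimage] by simp
qed

lemma radial_subgroup_of_real_Re: "z \<in> radial_subgroup (of_real r) \<Longrightarrow> of_real (Re z) = z"
  by (auto simp: radial_subgroup_def)

text \<open>In the chart, a full group meets a set exactly if the radial subgroup on the real axis
  meets the projection of that set, so both semicontinuity statements for radial subgroups carry
  over.\<close>

lemma continuous_map_full_group: "continuous_map (top_of_set {0..1}) C_Aff full_group"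
  unfolding C_Aff_def
proof (rule Aff.continuous_map_into_chabauty)
  show "full_group \<in> topspace (top_of_set {0..1}) \<rightarrow> closed_subgroups Aff Aff_top"
    using full_group_closed_subgroup by auto
next
  have cont: "continuous_map (top_of_set {0..1}) (top_of_set (cball 0 1)) complex_of_real"
    by (auto simp: continuous_map_in_subtopology intro!: continuous_intros)
  have pre: "openin (top_of_set {0..1}) {r \<in> topspace (top_of_set {0..1}). P (of_real r)}"
    if "openin (top_of_set (cball 0 1)) {w \<in> cball 0 1. P w}" for P :: "complex \<Rightarrow> bool"
  proof -
    have "{r \<in> topspace (top_of_set {0..1::real}). complex_of_real r \<in> {w \<in> cball 0 1. P w}}
        = {r \<in> topspace (top_of_set {0..1}). P (of_real r)}"
      by auto
    then show ?thesis
      using openin_continuous_map_preimage[OF cont that] by simp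
  qed
  {
    fix K assume "compactin Aff_top K"
    then have "compact ((\<lambda>z. complex_of_real (Re z)) ` (aff_exp -` K))"
      by (intro compact_continuous_image compact_aff_exp_vimage continuous_intros)
    moreover have "full_group r \<inter> K = {} \<longleftrightarrow>
        radial_subgroup (of_real r) \<inter> (\<lambda>z. complex_of_real (Re z)) ` (aff_exp -` K) = {}" for r
      unfolding full_group_eq_image by auto
    ultimately show "openin (top_of_set {0..1}) {r \<in> topspace (top_of_set {0..1}). full_group r \<inter> K = {}}"
      using pre[OF openin_radial_miss] by simp
  next
    fix V assume V: "openin Aff_top V"
    \<comment> \<open>The union of all vertical lines that meet the open set; unlike the projection
      to the real axis it is open in the plane.\<close>
    define V' where "V' = (\<Union>t. (\<lambda>z. Complex (Re z) t) -` (aff_exp -` V))"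
    have "open V'"
      unfolding V'_def Complex_eq
      by (intro open_UN ballI open_vimage open_aff_exp_vimage V continuous_intros)
    moreover have "full_group r \<inter> V \<noteq> {} \<longleftrightarrow> radial_subgroup (of_real r) \<inter> V' \<noteq> {}" for r
    proof -
      have "full_group r \<inter> V \<noteq> {} \<longleftrightarrow> (\<exists>z. of_real (Re z) \<in> radial_subgroup (of_real r) \<and> aff_exp z \<in> V)"
        unfolding full_group_eq_image by blast
      also have "\<dots> \<longleftrightarrow> (\<exists>s t. of_real s \<in> radial_subgroup (of_real r) \<and> aff_exp (Complex s t) \<in> V)"
        by (metis complex.collapse complex.sel(1))
      also have "\<dots> \<longleftrightarrow> radial_subgroup (of_real r) \<inter> V' \<noteq> {}"
        unfolding V'_def using radial_subgroup_of_real_Re by force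
      finally show ?thesis .
    qed
    ultimately show "openin (top_of_set {0..1}) {r \<in> topspace (top_of_set {0..1}). full_group r \<inter> V \<noteq> {}}"
      using pre[OF openin_radial_hit] by simp
  }
qed

section \<open>Classification of the closed subgroups\<close>

lemma closed_vimage_Aff:
  assumes "closedin Aff_top H" "continuous_on UNIV f" "\<And>x. f x \<in> carrier Aff"
  shows "closed {x. f x \<in> H}"
proof -
  obtain C where C: "closed C" "H = C \<inter> carrier Aff"
    using assms(1) by (auto simp: Aff_top_def closedin_closed)
  then have "{x. f x \<in> H} = f -` C"
    using assms(3) by auto
  then show ?thesis
    using assms(2) C(1) by (simp add: closed_vimage)
qed

lemma line_group_of_subgroup:
  assumes "additive_subgroup A" "closed A" "v \<noteq> 0" "H = aff_exp ` (\<lambda>\<tau>. of_real \<tau> * v) ` A"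
  shows "\<exists>w. norm w \<le> 1 \<and> H = line_group w"
proof -
  obtain r where r: "0 \<le> r" "r \<le> 1"
    and eq: "(\<lambda>\<tau>. of_real \<tau> * v) ` A = radial_subgroup (of_real (r / norm v) * v)"
    using closed_subgroup_of_line_is_radial[OF assms(1-3)] .
  have "norm (of_real (r / norm v) * v) \<le> 1"
    using r assms(3) by (simp add: norm_mult norm_divide)
  then show ?thesis
    using eq assms(4) unfolding line_group_def by blast
qed

lemma closed_subgroup_Aff_cases:
  assumes "H \<in> closed_subgroups Aff Aff_top"
  shows "(\<exists>w. norm w \<le> 1 \<and> H = line_group w) \<or> (\<exists>r. 0 \<le> r \<and> r \<le> 1 \<and> H = full_group r)"
proof -
  have H: "subgroup H Aff" "closedin Aff_top H"
    using assms by (auto simp: closed_subgroups_def)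
  define M where "M s t \<longleftrightarrow> aff_matrix s t \<in> H" for s t
  have H_eq: "H = {aff_matrix s t |s t. M s t}"
    using subgroup.subset[OF H(1)] by (auto simp: M_def carrier_Aff)
  have M_one: "M 0 0"
    using subgroup.one_closed[OF H(1)] by (simp add: M_def)
  have M_mult: "M (s + s') (exp s * t' + t)" if "M s t" "M s' t'" for s t s' t'
    using subgroup.m_closed[OF H(1)] that by (simp add: M_def aff_matrix_mult[symmetric])
  have M_inv: "M (- s) (- exp (- s) * t)" if "M s t" for s t
    using subgroup.m_inv_closed[OF H(1)] that by (metis M_def inv_Aff)
  have M_diff: "M (s - s') (t - exp (s - s') * t')" if "M s t" "M s' t'" for s t s' t'
    using M_mult[OF that(1) M_inv[OF that(2)]] by (simp add: exp_diff exp_minus field_simps)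
  define T where "T = {t. M 0 t}"
  have T: "additive_subgroup T"
    using M_one M_diff[of 0 _ 0] by (auto simp: additive_subgroup_def T_def)
  have T_closed: "closed T"
    unfolding T_def M_def
    by (intro closed_vimage_Aff H continuous_on_aff_matrix continuous_intros) auto
  show ?thesis
  proof (cases "\<forall>s t. M s t \<longrightarrow> s = 0")
    case True
    then have "H = {aff_matrix 0 t |t. t \<in> T}"
      unfolding H_eq T_def by auto
    also have "\<dots> = aff_exp ` (\<lambda>\<tau>. of_real \<tau> * \<i>) ` T"
      by (auto simp: image_image aff_exp_Re_0)
    finally show ?thesis
      using line_group_of_subgroup[OF T T_closed, of \<i>] by simp
  next
    case False
    then obtain s0 t0 where st0: "M s0 t0" "s0 \<noteq> 0" by blast
    show ?thesis
    proof (cases "T = {0}")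
      case True
      \<comment> \<open>Chosen so that the one-parameter group in direction \<open>v\<close> passes
        through \<open>aff_matrix s0 t0\<close>; the common fixed point is
        \<open>- b\<close>.\<close>
      define b where "b = t0 / (exp s0 - 1)"
      define v where "v = Complex 1 b"
      have v: "aff_exp (of_real s * v) = aff_matrix s (b * (exp s - 1))" for s
        unfolding exp_quotient_mult[symmetric] by (simp add: aff_exp_def v_def)
      have uniq: "t = t'" if "M s t" "M s t'" for s t t'
      proof -
        have "t - t' \<in> T"
          using M_diff[OF that] by (simp add: T_def)
        then show ?thesis
          using True by simp
      qed
      \<comment> \<open>The products in the two orders have the same dilation factor, hence agree by
        \<open>uniq\<close>. Commuting with \<open>aff_matrix s0 t0\<close> means fixing the same
        point.\<close>
      have M_line: "t = b * (exp s - 1)" if "M s t" for s t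
      proof -
        have "exp s * t0 + t = exp s0 * t + t0"
          using M_mult[OF that st0(1)] M_mult[OF st0(1) that] by (intro uniq) (simp_all add: add.commute)
        then have "t * (exp s0 - 1) = t0 * (exp s - 1)"
          by (simp add: algebra_simps)
        then show ?thesis
          using st0(2) by (simp add: b_def field_simps)
      qed
      define A where "A = {s. M s (b * (exp s - 1))}"
      have "0 \<in> A"
        using M_one by (simp add: A_def)
      moreover have "s - s' \<in> A" if "s \<in> A" "s' \<in> A" for s s'
        using that M_diff M_line unfolding A_def by fastforce
      ultimately have A: "additive_subgroup A"
        unfolding additive_subgroup_def by blast
      have "closed A"
        unfolding A_def M_def
        by (intro closed_vimage_Aff H continuous_on_aff_matrix continuous_intros) auto
      moreover have "H = aff_exp ` (\<lambda>\<tau>. of_real \<tau> * v) ` A"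
        unfolding H_eq image_image v A_def using M_line by blast
      moreover have "v \<noteq> 0"
        by (simp add: v_def complex_eq_iff)
      ultimately show ?thesis
        using line_group_of_subgroup[OF A] by blast
    next
      case False
      \<comment> \<open>The values \<open>s = 2 * s0\<close> and \<open>s = 0\<close> stand for
        rescaling by \<open>exp s0\<close> and \<open>exp (- s0)\<close>, that is, for conjugation
        by \<open>aff_matrix s0 t0\<close> and by its inverse. One of them contracts, whatever the
        sign of \<open>s0\<close>.\<close>
      have conj: "exp (s - s0) * t \<in> T" if "t \<in> T" "s = 0 \<or> s = 2 * s0" for s t
      proof -
        have pos: "exp s0 * t \<in> T"
          using M_diff[OF M_mult[OF st0(1), of 0 t] st0(1)] that(1) by (simp add: T_def)
        have "M (- s0) (- exp (- s0) * t0)"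
          using M_inv[OF st0(1)] .
        then have "exp (- s0) * t \<in> T"
          using M_diff[OF M_mult[of "- s0" "- exp (- s0) * t0" 0 t], of "- s0" "- exp (- s0) * t0"] that(1)
          by (simp add: T_def)
        with pos show ?thesis
          using that(2) by auto
      qed
      have "T = UNIV"
      proof -
        obtain \<mu> where \<mu>: "\<mu> \<ge> 0" "T = {\<tau>. \<tau> / \<mu> \<in> \<int>}"
          using closed_additive_subgroup_real[OF T T_closed] False by blast
        \<comment> \<open>Otherwise \<open>T\<close> would be generated by \<open>\<mu>\<close> and
          yet contain \<open>exp (- \<bar>s0\<bar>) * \<mu>\<close>, which lies strictly between 0
          and \<open>\<mu>\<close>.\<close>
        have "\<mu> = 0"
        proof (rule ccontr)
          assume "\<mu> \<noteq> 0"
          then have "\<mu> \<in> T"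
            unfolding \<mu> by simp
          then have "exp (- \<bar>s0\<bar>) * \<mu> \<in> T"
            using conj[of \<mu> 0] conj[of \<mu> "2 * s0"] by (cases "s0 \<ge> 0") auto
          then have "exp (- \<bar>s0\<bar>) \<in> \<int>"
            using \<open>\<mu> \<noteq> 0\<close> unfolding \<mu> by simp
          then have "\<bar>exp (- \<bar>s0\<bar>)\<bar> \<ge> 1"
            by (rule Ints_nonzero_abs_ge1) simp
          then show False
            using st0(2) by simp
        qed
        then show ?thesis
          using \<mu> by simp
      qed
      then have M0: "M 0 t" for t
        by (auto simp: T_def)
      \<comment> \<open>Left multiplication by the translations, all of which lie in
        \<open>H\<close>, changes \<open>t\<close> arbitrarily and leaves \<open>s\<close>
        fixed.\<close>
      have M_iff: "M s t \<longleftrightarrow> M s 0" for s t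
        using M_mult[OF M0[of t], of s 0] M_mult[OF M0[of "- t"], of s t] by auto
      define A where "A = {s. M s 0}"
      have A: "additive_subgroup A"
        using M_one M_diff[of _ 0 _ 0] by (auto simp: A_def additive_subgroup_def)
      have "closed A"
        unfolding A_def M_def
        by (intro closed_vimage_Aff H continuous_on_aff_matrix continuous_intros) auto
      then obtain r where r: "0 \<le> r" "r \<le> 1" "(\<lambda>\<tau>. of_real \<tau> * 1) ` A = radial_subgroup (of_real r)"
        using closed_subgroup_of_line_is_radial[OF A, of 1] by auto
      have "M s t \<longleftrightarrow> complex_of_real s \<in> radial_subgroup (of_real r)" for s t
        unfolding r(3)[symmetric] using M_iff[of s t] by (auto simp: A_def)
      then have "H = full_group r"
        unfolding H_eq full_group_def by simp
      then show ?thesis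
        using r by blast
    qed
  qed
qed

section \<open>Coincidences within and between the two families\<close>

lemma line_group_eq_iff:
  assumes "norm w \<le> 1" "norm v \<le> 1"
  shows "line_group w = line_group v \<longleftrightarrow> w = v \<or> w = - v"
  unfolding line_group_def inj_image_eq_iff[OF inj_aff_exp] by (rule radial_subgroup_eq_iff[OF assms])

lemma full_group_inj:
  assumes "0 \<le> r" "r \<le> 1" "0 \<le> r'" "r' \<le> 1" "full_group r = full_group r'"
  shows "r = r'"
proof -
  have "complex_of_real s \<in> radial_subgroup (of_real r) \<longleftrightarrow> aff_matrix s 0 \<in> full_group r" for s r
    by (auto simp: full_group_def)
  then have "radial_subgroup (of_real r) = radial_subgroup (of_real r')"
    using assms(5) radial_subgroup_of_real_Re by (metis (no_types, opaque_lifting) subsetI subset_antisym)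
  then show ?thesis
    using radial_subgroup_eq_iff[of "of_real r" "of_real r'"] assms by (auto simp flip: of_real_minus)
qed

lemma line_group_0: "line_group 0 = {aff_matrix 0 0}"
  by (simp add: line_group_def)

lemma full_group_0: "full_group 0 = line_group \<i>"
proof -
  have "line_group \<i> = (\<lambda>\<tau>. aff_exp (of_real \<tau> * \<i>)) ` UNIV"
    by (simp add: line_group_def radial_subgroup_unit image_image)
  then show ?thesis
    by (auto simp: full_group_def aff_exp_Re_0)
qed

text \<open>Arbitrarily short nonzero vectors force \<open>norm w = 1\<close> through the lower
  bound on lengths, and a line containing \<open>\<i>\<close> is spanned by it.\<close>

lemma vertical_radial_subgroup:
  assumes w: "norm w \<le> 1" and vert: "\<And>t. t > 0 \<Longrightarrow> of_real t * \<i> \<in> radial_subgroup w"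
  shows "w = \<i> \<or> w = - \<i>"
proof -
  have "1 \<le> norm w"
  proof (rule field_le_epsilon)
    fix e :: real assume "e > 0"
    then have "1 - norm w \<le> norm (of_real e * \<i>) * norm w"
      using w vert by (intro radial_subgroup_norm_bound) auto
    also have "\<dots> \<le> e"
      using \<open>e > 0\<close> w by (simp add: norm_mult mult_left_le)
    finally show "1 \<le> norm w + e" by simp
  qed
  then have n: "norm w = 1"
    using w by simp
  obtain \<tau> where \<tau>: "\<i> = of_real \<tau> * w"
    using vert[of 1] by (auto simp: radial_subgroup_def)
  then have "\<bar>\<tau>\<bar> = 1"
    using n by (metis norm_ii norm_mult norm_of_real mult.right_neutral)
  then have "\<tau> = 1 \<or> \<tau> = - 1"
    by linarith
  then have "\<i> = w \<or> \<i> = - w"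
    using \<tau> by auto
  then show ?thesis
    by (metis minus_minus)
qed

lemma vertical_line_group:
  assumes "norm w \<le> 1" "\<And>t. t > 0 \<Longrightarrow> aff_matrix 0 t \<in> line_group w"
  shows "w = \<i> \<or> w = - \<i>"
proof (rule vertical_radial_subgroup[OF assms(1)])
  fix t :: real assume "t > 0"
  then have "aff_exp (of_real t * \<i>) \<in> line_group w"
    using assms(2) by (simp add: aff_exp_Re_0)
  then show "of_real t * \<i> \<in> radial_subgroup w"
    by (auto simp: line_group_def)
qed

text \<open>Every full group contains all translations, so the translation group is the only
  subgroup common to both families. It is the point where the interval is attached to the
  disc.\<close>

lemma line_group_eq_full_group_iff:
  assumes "norm w \<le> 1" "0 \<le> r" "r \<le> 1"
  shows "line_group w = full_group r \<longleftrightarrow> r = 0 \<and> (w = \<i> \<or> w = - \<i>)"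
proof
  assume eq: "line_group w = full_group r"
  have "complex_of_real 0 \<in> radial_subgroup (of_real r)"
    using additive_subgroup_radial by (simp add: additive_subgroup_def)
  then have "aff_matrix 0 t \<in> line_group w" for t
    unfolding eq full_group_def by blast
  then have w: "w = \<i> \<or> w = - \<i>"
    using vertical_line_group[OF assms(1)] by blast
  then have "full_group 0 = full_group r"
    using eq by (auto simp: full_group_0 line_group_def)
  then show "r = 0 \<and> (w = \<i> \<or> w = - \<i>)"
    using w full_group_inj[of 0 r] assms by auto
qed (auto simp: full_group_0 line_group_def)

section \<open>Closed normal subgroups\<close>

lemma N_Aff_eq: "N_Aff = {{\<one>\<^bsub>Aff\<^esub>}} \<union> full_group ` {0..1}"
proof (intro equalityI subsetI)
  fix H assume "H \<in> N_Aff"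
  then have H: "H \<in> closed_subgroups Aff Aff_top" "H \<lhd> Aff"
    by (auto simp: N_Aff_def)
  \<comment> \<open>Conjugation by \<open>aff_matrix s t\<close> preserves \<open>a\<close>: the
    dilation rescales \<open>b\<close>, and the translation shifts it unless
    \<open>a = 0\<close>.\<close>
  have conj: "aff_matrix a (exp s * b + t * (1 - exp a)) \<in> H" if "aff_matrix a b \<in> H" for a b s t
  proof -
    have "aff_matrix s t \<otimes>\<^bsub>Aff\<^esub> aff_matrix a b \<otimes>\<^bsub>Aff\<^esub> inv\<^bsub>Aff\<^esub> aff_matrix s t \<in> H"
      using H(2) that by (simp add: group.normal_inv_iff[OF group_Aff] del: mult_Aff)
    then show ?thesis
      by (simp add: inv_Aff aff_matrix_mult exp_add exp_minus algebra_simps)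
  qed
  from closed_subgroup_Aff_cases[OF H(1)]
  show "H \<in> {{\<one>\<^bsub>Aff\<^esub>}} \<union> full_group ` {0..1}"
  proof (elim disjE exE conjE)
    fix w assume w: "norm w \<le> 1" "H = line_group w"
    show ?thesis
    proof (cases "w = 0")
      case False
      obtain z where z: "z \<in> radial_subgroup w" "z \<noteq> 0"
        using radial_subgroup_short_element[OF w(1) False zero_less_one] by blast
      define a b where "a = Re z" and "b = Im z * exp_quotient (Re z)"
      have ab: "aff_matrix a b \<in> H"
        using z by (auto simp: w line_group_def a_def b_def aff_exp_def)
      \<comment> \<open>If \<open>a \<noteq> 0\<close>, conjugation by a translation produces a
        second element with the same \<open>a\<close>, but a line group has at most one element for
        each nonzero \<open>a\<close>.\<close>
      have "a = 0"
      proof (rule ccontr)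
        assume "a \<noteq> 0"
        have "aff_matrix a b \<in> line_group w" "aff_matrix a (b + (1 - exp a)) \<in> line_group w"
          using conj[OF ab, of 0 0] conj[OF ab, of 0 1] by (simp_all add: w)
        then obtain \<sigma> \<tau> where st: "aff_matrix a b = aff_exp (of_real \<sigma> * w)"
          "aff_matrix a (b + (1 - exp a)) = aff_exp (of_real \<tau> * w)"
          unfolding line_group_def radial_subgroup_def by blast
        have "a = \<sigma> * Re w"
          using st(1) by (simp add: aff_exp_def)
        moreover have "a = \<tau> * Re w"
          using st(2) by (simp add: aff_exp_def)
        ultimately have "\<sigma> = \<tau>"
          using \<open>a \<noteq> 0\<close> by (metis mult_cancel_right mult_zero_right)
        then show False
          using st \<open>a \<noteq> 0\<close> by (metis aff_matrix_eq_iff add_cancel_left_right eq_iff_diff_eq_0 exp_eq_one_iff)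
      qed
      then have "b \<noteq> 0"
        using z(2) exp_quotient_nonzero by (auto simp: a_def b_def complex_eq_iff)
      \<comment> \<open>Conjugation by the dilation with factor \<open>t / \<bar>b\<bar>\<close>
        reaches the translation by \<open>t * sgn b\<close>, and inversion corrects the
        sign.\<close>
      have "aff_matrix 0 t \<in> H" if "t > 0" for t
      proof -
        have "aff_matrix 0 (exp (ln (t / \<bar>b\<bar>)) * b) \<in> H"
          using conj[OF ab, of "ln (t / \<bar>b\<bar>)" 0] \<open>a = 0\<close> by simp
        then have t: "aff_matrix 0 (t * sgn b) \<in> H"
          using that \<open>b \<noteq> 0\<close> by (simp add: sgn_if abs_if split: if_splits)
        have "subgroup H Aff"
          using H(1) by (simp add: closed_subgroups_def)
        then have "aff_matrix 0 (- (t * sgn b)) \<in> H"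
          using subgroup.m_inv_closed[of H Aff, OF _ t] by (simp add: inv_Aff)
        with t show ?thesis
          using \<open>b \<noteq> 0\<close> by (cases "b > 0") auto
      qed
      then have "w = \<i> \<or> w = - \<i>"
        using vertical_line_group w by blast
      then have "H = full_group 0"
        using w(2) by (auto simp: full_group_0 line_group_def)
      then show ?thesis by auto
    qed (simp add: w line_group_0)
  qed auto
next
  fix H assume "H \<in> {{\<one>\<^bsub>Aff\<^esub>}} \<union> full_group ` {0..1}"
  then consider "H = {\<one>\<^bsub>Aff\<^esub>}" | r where "0 \<le> r" "r \<le> 1" "H = full_group r"
    by auto
  then show "H \<in> N_Aff"
  proof cases
    case 1
    then have "H \<in> closed_subgroups Aff Aff_top"
      using line_group_closed_subgroup[of 0] by (simp add: line_group_0)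
    then show ?thesis
      using 1 group.one_is_normal[OF group_Aff] by (simp add: N_Aff_def)
  next
    case 2
    have conj: "aff_matrix s t \<otimes>\<^bsub>Aff\<^esub> aff_matrix a b \<otimes>\<^bsub>Aff\<^esub> inv\<^bsub>Aff\<^esub> aff_matrix s t \<in> H"
      if "aff_matrix a b \<in> H" for a b s t
      using that 2 by (auto simp: inv_Aff aff_matrix_mult full_group_def)
    have "x \<otimes>\<^bsub>Aff\<^esub> h \<otimes>\<^bsub>Aff\<^esub> inv\<^bsub>Aff\<^esub> x \<in> H" if x: "x \<in> carrier Aff" and h: "h \<in> H" for x h
    proof -
      obtain s t where "x = aff_matrix s t"
        using x by (auto simp: carrier_Aff)
      moreover obtain a b where "h = aff_matrix a b"
        using h 2(3) by (auto simp: full_group_def)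
      ultimately show ?thesis
        using conj h by blast
    qed
    then show ?thesis
      using full_group_closed_subgroup[of r] 2
      by (auto simp: N_Aff_def closed_subgroups_def group.normal_inv_iff[OF group_Aff] simp del: mult_Aff)
  qed
qed

section \<open>Closed subgroups isomorphic to the real line\<close>

lemma line_group_isomorphic_real:
  assumes w: "norm w = 1"
  shows "line_group w \<in> R_subgroups_Aff"
proof -
  define \<gamma> where "\<gamma> \<tau> = aff_exp (of_real \<tau> * w)" for \<tau> :: real
  define f where "f x = Re (aff_log x / w)" for x
  have "w \<noteq> 0" using w by auto
  then have f\<gamma> [simp]: "f (\<gamma> \<tau>) = \<tau>" for \<tau>
    by (simp add: f_def \<gamma>_def)
  have L: "line_group w = range \<gamma>"
    by (simp add: line_group_def radial_subgroup_unit[OF w] image_image \<gamma>_def)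
  have mult: "\<gamma> \<sigma> \<otimes>\<^bsub>Aff\<^esub> \<gamma> \<tau> = \<gamma> (\<sigma> + \<tau>)" for \<sigma> \<tau>
    unfolding \<gamma>_def mult_Aff by (rule aff_exp_mult_collinear)
  have "f \<in> iso (Aff\<lparr>carrier := line_group w\<rparr>) real_group"
  proof (rule isoI)
    show "f \<in> hom (Aff\<lparr>carrier := line_group w\<rparr>) real_group"
      by (rule homI) (auto simp: L mult real_group_def simp del: mult_Aff)
    show "bij_betw f (carrier (Aff\<lparr>carrier := line_group w\<rparr>)) (carrier real_group)"
      by (rule bij_betw_byWitness[where f' = \<gamma>]) (auto simp: L real_group_def)
  qed
  moreover have "homeomorphic_maps (subtopology Aff_top (line_group w)) euclideanreal f \<gamma>"
    unfolding homeomorphic_maps_def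
  proof (intro conjI ballI)
    have "continuous_map Aff_top euclideanreal f"
      unfolding f_def Aff_top_def using \<open>w \<noteq> 0\<close> by (auto intro!: continuous_intros continuous_on_aff_log)
    then show "continuous_map (subtopology Aff_top (line_group w)) euclideanreal f"
      by (rule continuous_map_from_subtopology)
    have "continuous_on UNIV \<gamma>"
      unfolding \<gamma>_def by (intro continuous_on_compose2[OF continuous_on_aff_exp[of UNIV]] continuous_intros) auto
    then show "continuous_map euclideanreal (subtopology Aff_top (line_group w)) \<gamma>"
      by (auto simp: continuous_map_in_subtopology Aff_top_def L) (simp add: \<gamma>_def)
  qed (auto simp: L)
  then have "homeomorphic_map (subtopology Aff_top (line_group w)) euclideanreal f"
    using homeomorphic_map_maps by blast
  ultimately show ?thesis
    using line_group_closed_subgroup[of w] w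
    unfolding R_subgroups_Aff_def topologically_isomorphic_def by auto
qed

lemma R_subgroups_Aff_eq: "R_subgroups_Aff = line_group ` sphere 0 1"
proof (intro equalityI subsetI)
  fix H assume "H \<in> R_subgroups_Aff"
  then obtain f where H: "H \<in> closed_subgroups Aff Aff_top" and f: "f \<in> iso (Aff\<lparr>carrier := H\<rparr>) real_group"
    by (auto simp: R_subgroups_Aff_def topologically_isomorphic_def)
  have bij: "bij_betw f H UNIV" and hom: "\<And>x y. \<lbrakk>x \<in> H; y \<in> H\<rbrakk> \<Longrightarrow> f (x ** y) = f x + f y"
    using f by (auto simp: iso_def hom_def real_group_def)
  from closed_subgroup_Aff_cases[OF H] show "H \<in> line_group ` sphere 0 1"
  proof (elim disjE exE conjE)
    fix w assume w: "norm w \<le> 1" "H = line_group w"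
    \<comment> \<open>Line groups with \<open>norm w < 1\<close> are countable, so uncountability
      leaves only the unit vectors.\<close>
    have "\<not> countable H"
      using bij uncountable_UNIV_real by (metis bij_betw_def countable_image)
    then have "norm w = 1"
      using countable_radial_subgroup[of w] w unfolding line_group_def by fastforce
    then show ?thesis
      using w by auto
  next
    fix r assume r: "0 \<le> r" "r \<le> 1" "H = full_group r"
    \<comment> \<open>For \<open>r \<noteq> 0\<close> the group contains a translation and a
      dilation that do not commute, whereas the real line is commutative.\<close>
    have "r = 0"
    proof (rule ccontr)
      assume "r \<noteq> 0"
      then obtain z where z: "z \<in> radial_subgroup (of_real r)" "z \<noteq> 0"
        using radial_subgroup_short_element[of "of_real r" 1] r by auto
      define s where "s = Re z"
      have s: "of_real s \<in> radial_subgroup (of_real r)" "s \<noteq> 0"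
        using z radial_subgroup_of_real_Re[OF z(1)] unfolding s_def by (metis, metis of_real_0)
      have "complex_of_real 0 \<in> radial_subgroup (of_real r)"
        using additive_subgroup_radial by (simp add: additive_subgroup_def)
      then have x: "aff_matrix 0 1 \<in> H" and y: "aff_matrix s 0 \<in> H"
        and xy: "aff_matrix s 1 \<in> H" "aff_matrix s (exp s) \<in> H"
        using s(1) unfolding r full_group_def by blast+
      have "f (aff_matrix s 1) = f (aff_matrix s (exp s))"
        using hom[OF x y] hom[OF y x] by (simp add: aff_matrix_mult)
      then have "aff_matrix s 1 = aff_matrix s (exp s)"
        using inj_onD[OF bij_betw_imp_inj_on[OF bij]] xy by blast
      then show False
        using s(2) by simp
    qed
    then show ?thesis
      using r full_group_0 by auto
  qed
qed (auto simp: line_group_isomorphic_real)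

section \<open>The Chabauty space of the affine group\<close>

lemma quotient_map_onto_image:
  assumes "continuous_map X Y f" "compact_space X" "Hausdorff_space Y"
  shows "quotient_map X (subtopology Y (f ` topspace X)) f"
proof (rule continuous_imp_quotient_map)
  show "f ` topspace X = topspace (subtopology Y (f ` topspace X))"
    using continuous_map_image_subset_topspace[OF assms(1)] by auto
qed (use assms in \<open>auto simp: continuous_map_in_subtopology Hausdorff_space_subtopology\<close>)

lemma homeomorphic_map_onto_image:
  assumes "continuous_map X Y f" "compact_space X" "Hausdorff_space Y" "inj_on f (topspace X)"
  shows "homeomorphic_map X (subtopology Y (f ` topspace X)) f"
  using quotient_map_onto_image[OF assms(1-3)] assms(4) by (simp add: homeomorphic_map_def)

abbreviation disc :: "(real^2^2) set set" where
  "disc \<equiv> line_group ` cball 0 1"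

abbreviation segment :: "(real^2^2) set set" where
  "segment \<equiv> full_group ` {0..1}"

lemma closed_subgroups_Aff_eq: "closed_subgroups Aff Aff_top = disc \<union> segment"
proof (intro equalityI subsetI)
  fix H assume "H \<in> closed_subgroups Aff Aff_top"
  then show "H \<in> disc \<union> segment"
    using closed_subgroup_Aff_cases[of H] by fastforce
qed (use line_group_closed_subgroup full_group_closed_subgroup in auto)

lemma closedin_disc: "closedin C_Aff disc"
  by (rule compactin_imp_closedin[OF Hausdorff_C_Aff])
    (rule image_compactin[OF _ continuous_map_line_group], simp add: compactin_subtopology)

lemma closedin_segment: "closedin C_Aff segment"
  by (rule compactin_imp_closedin[OF Hausdorff_C_Aff])
    (rule image_compactin[OF _ continuous_map_full_group], simp add: compactin_subtopology)

lemma disc_Int_segment: "disc \<inter> segment = {full_group 0}"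
  using line_group_eq_full_group_iff by (fastforce simp: full_group_0)

section \<open>The disc of line groups and the plane model of the whole space\<close>

lemma line_group_csqrt_square [simp]: "line_group (csqrt (w\<^sup>2)) = line_group w"
proof -
  have "csqrt (w\<^sup>2) = w \<or> csqrt (w\<^sup>2) = - w"
    using power2_eq_iff power2_csqrt by blast
  then show ?thesis
    by (auto simp: line_group_def)
qed

text \<open>Meant for the disc and its boundary circle, where membership depends on the norm in a
  way that squaring does not affect.\<close>

lemma line_group_csqrt_image:
  assumes "\<And>w. w\<^sup>2 \<in> W \<longleftrightarrow> w \<in> W"
  shows "(\<lambda>z. line_group (csqrt z)) ` W = line_group ` W"
proof (intro equalityI subsetI)
  fix L assume "L \<in> (\<lambda>z. line_group (csqrt z)) ` W"
  then obtain z where "z \<in> W" "L = line_group (csqrt z)" by blast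
  then show "L \<in> line_group ` W"
    using assms[of "csqrt z"] by auto
next
  fix L assume "L \<in> line_group ` W"
  then obtain w where "w \<in> W" "L = line_group w" by blast
  then show "L \<in> (\<lambda>z. line_group (csqrt z)) ` W"
    using assms[of w] by (intro image_eqI[of _ _ "w\<^sup>2"]) auto
qed

text \<open>\<open>csqrt\<close> jumps by a sign across the negative real axis, but
  \<open>line_group\<close> ignores signs. Continuity is obtained by descending
  \<open>line_group\<close> along the quotient map \<open>\<lambda>w. w\<^sup>2\<close>, whose
  fibres are the pairs that \<open>line_group\<close> identifies.\<close>

lemma homeomorphic_map_disc:
  "homeomorphic_map (top_of_set (cball 0 1)) (subtopology C_Aff disc) (\<lambda>z. line_group (csqrt z))"
proof -
  have sq: "quotient_map (top_of_set (cball 0 1)) (top_of_set (cball 0 1)) (\<lambda>w::complex. w\<^sup>2)"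
  proof (rule continuous_imp_quotient_map)
    show "(\<lambda>w::complex. w\<^sup>2) ` topspace (top_of_set (cball 0 1)) = topspace (top_of_set (cball 0 1))"
    proof (intro equalityI subsetI)
      fix z :: complex assume "z \<in> topspace (top_of_set (cball 0 1))"
      then show "z \<in> (\<lambda>w. w\<^sup>2) ` topspace (top_of_set (cball 0 1))"
        by (intro image_eqI[of _ _ "csqrt z"]) auto
    qed (auto simp: norm_power power_le_one)
    show "continuous_map (top_of_set (cball 0 1)) (top_of_set (cball 0 1)) (\<lambda>w::complex. w\<^sup>2)"
      by (auto simp: continuous_map_in_subtopology norm_power power_le_one intro!: continuous_intros)
  qed (simp_all add: compact_space_subtopology Hausdorff_space_subtopology)
  have "continuous_map (top_of_set (cball 0 1)) C_Aff ((\<lambda>z. line_group (csqrt z)) \<circ> (\<lambda>w. w\<^sup>2))"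
    using continuous_map_line_group by (simp add: o_def)
  then have cont: "continuous_map (top_of_set (cball 0 1)) C_Aff (\<lambda>z. line_group (csqrt z))"
    by (rule continuous_compose_quotient_map[OF sq])
  have inj: "inj_on (\<lambda>z. line_group (csqrt z)) (cball 0 1)"
  proof (rule inj_onI)
    fix y z assume yz: "y \<in> cball 0 1" "z \<in> cball 0 1" "line_group (csqrt y) = line_group (csqrt z)"
    then have "csqrt y = csqrt z \<or> csqrt y = - csqrt z"
      using line_group_eq_iff[of "csqrt y" "csqrt z"] by simp
    then show "y = z"
      by (metis power2_csqrt power2_minus)
  qed
  have "(\<lambda>z. line_group (csqrt z)) ` cball 0 1 = disc"
    by (rule line_group_csqrt_image) (simp add: norm_power abs_square_le_1)
  then show ?thesis
    using homeomorphic_map_onto_image[OF cont _ Hausdorff_C_Aff] inj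
    by (simp add: compact_space_subtopology)
qed

lemma homeomorphic_map_segment:
  "homeomorphic_map (top_of_set {0..1}) (subtopology C_Aff segment) full_group"
proof -
  have "inj_on full_group {0..1}"
    using full_group_inj by (auto intro!: inj_onI)
  then show ?thesis
    using homeomorphic_map_onto_image[OF continuous_map_full_group _ Hausdorff_C_Aff]
    by (simp add: compact_space_subtopology)
qed

text \<open>A plane model of the space. The stick is attached at \<open>-1\<close>, the square of
  \<open>\<i>\<close>, because the translation group shared by both families is the line group of
  \<open>\<i>\<close>.\<close>

definition lollipop :: "complex set" where
  "lollipop = cball 0 1 \<union> of_real ` {-2..-1}"

text \<open>The stick lies on a ray from the centre of the disc, so shrinking towards 0 slides it
  along itself into the disc. Contractibility follows from this.\<close>

lemma starlike_lollipop: "starlike lollipop"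
  unfolding starlike_def
proof (intro bexI ballI subsetI)
  fix x z assume x: "x \<in> lollipop" and "z \<in> closed_segment 0 x"
  then obtain u where u: "0 \<le> u" "u \<le> 1" "z = of_real u * x"
    by (auto simp: in_segment scaleR_conv_of_real)
  show "z \<in> lollipop"
  proof (cases "norm x \<le> 1")
    case True
    then have "norm z \<le> 1"
      using u by (simp add: norm_mult mult_le_one)
    then show ?thesis by (simp add: lollipop_def)
  next
    case False
    then obtain s where s: "x = of_real s" "-2 \<le> s" "s \<le> -1"
      using x by (auto simp: lollipop_def)
    have "s \<le> u * s"
      using u s mult_right_mono_neg[of u 1 s] by simp
    then have "u * s \<ge> -2"
      using s(2) by linarith
    moreover have "u * s \<le> 0"
      using u s by (simp add: mult_nonneg_nonpos)
    moreover have "z = of_real (u * s)"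
      using u s by simp
    moreover have "of_real r \<in> lollipop" if "-2 \<le> r" "r \<le> 0" for r :: real
      using that by (cases "r \<le> -1") (auto simp: lollipop_def)
    ultimately show ?thesis
      by metis
  qed
qed (simp add: lollipop_def)

lemma C_Aff_homeomorphic_lollipop: "top_of_set lollipop homeomorphic_space C_Aff"
proof -
  \<comment> \<open>The reflection \<open>- 1 - Re z\<close> carries the stick onto
    \<open>{0..1}\<close>, with the attaching point going to 0.\<close>
  define f where "f z = (if norm z \<le> 1 then line_group (csqrt z) else full_group (- 1 - Re z))" for z
  define F where "F b = (if b then (\<lambda>z. line_group (csqrt z)) else (\<lambda>z. full_group (- 1 - Re z)))" for b
  define S :: "bool \<Rightarrow> complex set" where "S b = (if b then cball 0 1 else of_real ` {-2..-1})" for b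
  have S: "lollipop = S True \<union> S False"
    by (simp add: lollipop_def S_def)
  have Int: "z = -1" if "z \<in> S True" "z \<in> S False" for z
    using that by (auto simp: S_def)
  have comp: "compact (S b)" for b
    by (auto simp: S_def intro!: compact_continuous_image continuous_intros)
  \<comment> \<open>Since \<open>csqrt (-1) = \<i>\<close>, both formulas give the translation group
    at the attaching point.\<close>
  have F_eq: "F True (-1) = F False (-1)"
    by (simp add: F_def full_group_0)
  have f_eq: "f z = F b z" if "z \<in> S b" for z b
  proof (cases b)
    case False
    then have "norm z \<le> 1 \<Longrightarrow> z = -1"
      using that Int[of z] by (simp add: S_def)
    then show ?thesis
      using False F_eq by (auto simp: f_def F_def)
  qed (use that in \<open>simp add: S_def f_def F_def\<close>)
  have "continuous_map (top_of_set lollipop) C_Aff f"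
  proof (rule pasting_lemma_closed[where I = UNIV and T = S and f = F])
    fix b
    have "compact (S b)" "S b \<subseteq> lollipop"
      using comp by (cases b; simp add: S)+
    then show "closedin (top_of_set lollipop) (S b)"
      by (simp add: closed_subset compact_imp_closed)
    have "continuous_map (top_of_set (S b)) C_Aff (F b)"
    proof (cases b)
      case True
      then show ?thesis
        using homeomorphic_imp_continuous_map[OF homeomorphic_map_disc]
        by (simp add: S_def F_def continuous_map_in_subtopology)
    next
      case False
      have "continuous_map (top_of_set (S False)) (top_of_set {0..1}) (\<lambda>z. - 1 - Re z)"
        by (auto simp: S_def continuous_map_in_subtopology intro!: continuous_intros)
      then have "continuous_map (top_of_set (S False)) C_Aff (full_group \<circ> (\<lambda>z. - 1 - Re z))"
        using continuous_map_full_group by (rule continuous_map_compose)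
      then show ?thesis
        using False by (simp add: F_def o_def)
    qed
    then show "continuous_map (subtopology (top_of_set lollipop) (S b)) C_Aff (F b)"
      using \<open>S b \<subseteq> lollipop\<close> by (simp add: subtopology_subtopology Int_absorb1)
  next
    fix z and b c :: bool assume z: "z \<in> topspace (top_of_set lollipop) \<inter> S b \<inter> S c"
    then show "F b z = F c z"
      using f_eq by (metis IntD1 IntD2)
  next
    fix z assume "z \<in> topspace (top_of_set lollipop)"
    then show "\<exists>b. b \<in> UNIV \<and> z \<in> S b \<and> f z = F b z"
      using S f_eq by (metis UNIV_I UnE topspace_euclidean_subtopology)
  qed simp
  moreover have "f ` lollipop = topspace C_Aff"
  proof -
    have "F True ` S True = disc"
      using homeomorphic_imp_surjective_map[OF homeomorphic_map_disc] closedin_subset[OF closedin_disc]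
      by (simp add: F_def S_def Int_absorb1)
    moreover have "F False ` S False = segment"
    proof -
      have "(\<lambda>s. - 1 - s) ` {-2..-1} = {0..1::real}"
        by (simp add: image_diff_atLeastAtMost)
      then have "full_group ` (\<lambda>s. - 1 - s) ` {-2..-1} = segment"
        by (rule arg_cong)
      then show ?thesis
        by (simp only: F_def S_def image_image if_False Re_complex_of_real)
    qed
    moreover have "f ` S b = F b ` S b" for b
      using f_eq by (auto intro: image_cong)
    ultimately show ?thesis
      by (simp add: S image_Un closed_subgroups_Aff_eq)
  qed
  moreover have "inj_on f lollipop"
  proof (rule inj_onI)
    have disc_inj: "inj_on (\<lambda>z. line_group (csqrt z)) (cball 0 1)"
      using homeomorphic_imp_injective_map[OF homeomorphic_map_disc] by simp
    \<comment> \<open>A subgroup in both families is the translation group, which determines both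
      parameters.\<close>
    have mixed: "y = z" if y: "y \<in> S True" and z: "z \<in> S False" and eq: "F True y = F False z" for y z
    proof -
      obtain s where s: "z = of_real s" "-2 \<le> s" "s \<le> -1"
        using z by (auto simp: S_def)
      have "line_group (csqrt y) = full_group (- 1 - s)"
        using eq s by (simp add: F_def)
      then have "- 1 - s = 0" "csqrt y = \<i> \<or> csqrt y = - \<i>"
        using y s line_group_eq_full_group_iff[of "csqrt y" "- 1 - s"] by (auto simp: S_def)
      then have "y = -1"
        by (metis power2_csqrt power2_i power2_minus)
      moreover have "s = -1"
        using \<open>- 1 - s = 0\<close> by simp
      ultimately show ?thesis
        using s(1) by simp
    qed
    fix y z assume yz: "y \<in> lollipop" "z \<in> lollipop" "f y = f z"
    then consider "y \<in> S True" "z \<in> S True" | "y \<in> S True" "z \<in> S False"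
      | "y \<in> S False" "z \<in> S True" | "y \<in> S False" "z \<in> S False"
      using S by blast
    then show "y = z"
    proof cases
      case 1
      then have "line_group (csqrt y) = line_group (csqrt z)" "y \<in> cball 0 1" "z \<in> cball 0 1"
        using yz(3) f_eq[of y True] f_eq[of z True] by (simp_all add: F_def S_def)
      then show ?thesis
        by (rule inj_onD[OF disc_inj])
    next
      case 2
      then show ?thesis
        using yz(3) mixed by (simp add: f_eq)
    next
      case 3
      then show ?thesis
        using yz(3) mixed[of z y] by (simp add: f_eq)
    next
      case 4
      then obtain s t where "y = of_real s" "-2 \<le> s" "s \<le> -1" "z = of_real t" "-2 \<le> t" "t \<le> -1"
        by (auto simp: S_def)
      moreover have "F False y = F False z"
        using 4 yz(3) by (simp add: f_eq)
      ultimately show ?thesis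
        using full_group_inj[of "- 1 - s" "- 1 - t"] by (simp add: F_def)
    qed
  qed
  moreover have "compact lollipop"
    using comp by (simp add: S compact_Un)
  ultimately have "homeomorphic_map (top_of_set lollipop) C_Aff f"
    using Hausdorff_C_Aff
    by (intro continuous_imp_homeomorphic_map) (simp_all add: compact_space_subtopology)
  then show ?thesis
    by (rule homeomorphic_map_imp_homeomorphic_space)
qed

section \<open>Compactness, contractibility and dimension\<close>

lemma compact_C_Aff: "compact_space C_Aff"
proof -
  have "compact lollipop"
    unfolding lollipop_def by (intro compact_Un compact_continuous_image continuous_intros) auto
  then have "compact_space (top_of_set lollipop)"
    by (simp add: compact_space_subtopology)
  then show ?thesis
    using homeomorphic_compact_space[OF C_Aff_homeomorphic_lollipop] by blast
qed

lemma contractible_C_Aff: "contractible_space C_Aff"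
  using homeomorphic_space_contractibility[OF C_Aff_homeomorphic_lollipop]
    starlike_imp_contractible[OF starlike_lollipop] by simp

lemma C_Aff_dim_le_2: "C_Aff dim_le 2"
  using homeomorphic_space_dimension_le[OF C_Aff_homeomorphic_lollipop] dim_le_2_complex by blast

lemma not_C_Aff_dim_le_1: "\<not> C_Aff dim_le 1"
proof
  assume "C_Aff dim_le 1"
  then have "subtopology C_Aff disc dim_le 1"
    by (rule dimension_le_subtopology)
  then show False
    using homeomorphic_space_dimension_le[OF homeomorphic_map_imp_homeomorphic_space[OF homeomorphic_map_disc]]
      not_dim_le_1_cball by blast
qed

section \<open>Identification of the real plane with the complex plane\<close>

definition plane_to_complex :: "real^2 \<Rightarrow> complex" where
  "plane_to_complex x = Complex (x $ 1) (x $ 2)"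

definition complex_to_plane :: "complex \<Rightarrow> real^2" where
  "complex_to_plane z = vector [Re z, Im z]"

lemma complex_to_plane_inverse [simp]: "plane_to_complex (complex_to_plane z) = z"
  by (simp add: plane_to_complex_def complex_to_plane_def)

lemma plane_to_complex_inverse [simp]: "complex_to_plane (plane_to_complex x) = x"
  by (simp add: plane_to_complex_def complex_to_plane_def vec_eq_iff forall_2)

lemma norm_plane_to_complex [simp]: "norm (plane_to_complex x) = norm x"
  by (simp add: plane_to_complex_def norm_vec_def L2_set_def sum_2 cmod_def)

lemma norm_complex_to_plane [simp]: "norm (complex_to_plane z) = norm z"
  by (metis complex_to_plane_inverse norm_plane_to_complex)

lemma continuous_on_plane_to_complex: "continuous_on S plane_to_complex"
  unfolding plane_to_complex_def Complex_eq by (intro continuous_intros)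

lemma continuous_on_complex_to_plane: "continuous_on S complex_to_plane"
proof -
  have eq: "complex_to_plane = (\<lambda>z. \<chi> i. if i = 1 then Re z else Im z)"
    by (auto simp: complex_to_plane_def vec_eq_iff forall_2)
  have "continuous_on S (\<lambda>z. if i = (1::2) then Re z else Im z)" for i
    by (cases "i = 1") (auto intro!: continuous_intros)
  then show ?thesis
    unfolding eq by (rule continuous_on_vec_lambda)
qed

lemma linear_plane_to_complex:
  "plane_to_complex (c *\<^sub>R x) = of_real c * plane_to_complex x"
  by (simp add: plane_to_complex_def complex_eq_iff)

lemma homeomorphic_map_plane_to_complex:
  "homeomorphic_map (top_of_set (cball 0 1)) (top_of_set (cball 0 1)) plane_to_complex"
proof -
  have "homeomorphic_maps (top_of_set (cball 0 1)) (top_of_set (cball 0 1)) plane_to_complex complex_to_plane"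
    by (auto simp: homeomorphic_maps_def continuous_map_in_subtopology
        continuous_on_plane_to_complex continuous_on_complex_to_plane)
  then show ?thesis
    using homeomorphic_map_maps by blast
qed

lemma plane_to_complex_image_sphere: "plane_to_complex ` sphere 0 1 = sphere 0 1"
proof (intro equalityI subsetI)
  fix z :: complex assume "z \<in> sphere 0 1"
  then show "z \<in> plane_to_complex ` sphere 0 1"
    by (intro image_eqI[of _ _ "complex_to_plane z"]) auto
qed auto

section \<open>The projective line of one-parameter subgroups and its cone\<close>

definition R_space :: "(real^2^2) set topology" where
  "R_space = subtopology C_Aff R_subgroups_Aff"

lemma topspace_R_space [simp]: "topspace R_space = line_group ` sphere 0 1"
  unfolding R_space_def R_subgroups_Aff_eq using line_group_closed_subgroup by auto

lemma quotient_map_sphere: "quotient_map (top_of_set (sphere 0 1)) R_space line_group"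
proof -
  have "continuous_map (top_of_set (sphere 0 1)) C_Aff line_group"
    by (rule continuous_map_from_subtopology_mono[OF continuous_map_line_group]) auto
  then show ?thesis
    using quotient_map_onto_image[OF _ _ Hausdorff_C_Aff, of "top_of_set (sphere 0 1)" line_group]
    by (simp add: compact_space_subtopology R_space_def R_subgroups_Aff_eq)
qed

text \<open>Normalising a nonzero vector and taking its line group is a quotient map, and its fibres
  are exactly the proportionality classes.\<close>

lemma R_space_homeomorphic_projective_line: "R_space homeomorphic_space real_projective_line"
proof -
  define u where "u v = sgn (plane_to_complex v)" for v
  have u: "u v = of_real (inverse (norm v)) * plane_to_complex v" for v
    by (simp add: u_def sgn_div_norm scaleR_conv_of_real)
  have nz: "plane_to_complex v \<noteq> 0 \<longleftrightarrow> v \<noteq> 0" for v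
    by (metis norm_eq_zero norm_plane_to_complex)
  have norm_u: "norm (u v) = 1" if "v \<noteq> 0" for v
    using that nz by (simp add: u_def norm_sgn)
  \<comment> \<open>On the circle \<open>complex_to_plane\<close> is a right inverse of the
    normalisation \<open>u\<close>, and retractions are quotient maps.\<close>
  have "retraction_maps (top_of_set (- {0})) (top_of_set (sphere 0 1)) u complex_to_plane"
    unfolding retraction_maps_def
  proof (intro conjI ballI)
    have "continuous_on (- {0}) u"
      unfolding u_def using nz by (intro continuous_intros continuous_on_plane_to_complex) auto
    then show "continuous_map (top_of_set (- {0})) (top_of_set (sphere 0 1)) u"
      using norm_u by (auto simp: continuous_map_in_subtopology)
    show "continuous_map (top_of_set (sphere 0 1)) (top_of_set (- {0})) complex_to_plane"
      by (auto simp: continuous_map_in_subtopology continuous_on_complex_to_plane)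
        (metis norm_complex_to_plane norm_zero zero_neq_one)
    fix z assume "z \<in> topspace (top_of_set (sphere (0::complex) 1))"
    then show "u (complex_to_plane z) = z"
      by (simp add: u)
  qed
  then have "quotient_map (top_of_set (- {0})) (top_of_set (sphere 0 1)) u"
    using retraction_imp_quotient_map retraction_map_def by blast
  then have q: "quotient_map (top_of_set (- {0})) R_space (line_group \<circ> u)"
    using quotient_map_sphere by (rule quotient_map_compose)
  have "(\<exists>c. y = c *\<^sub>R x) \<longleftrightarrow> line_group (u x) = line_group (u y)" if "x \<noteq> 0" "y \<noteq> 0" for x y
  proof -
    have eq: "line_group (u x) = line_group (u y) \<longleftrightarrow> u x = u y \<or> u x = - u y"
      using norm_u that by (intro line_group_eq_iff) auto
    \<comment> \<open>Only the sign of the factor survives normalisation, and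
      \<open>line_group\<close> ignores it.\<close>
    have "u (c *\<^sub>R x) = of_real (sgn c) * u x" for c
      by (simp add: u_def linear_plane_to_complex sgn_mult sgn_of_real)
    then have "line_group (u x) = line_group (u y)" if "y = c *\<^sub>R x" for c
      using that \<open>y \<noteq> 0\<close> unfolding eq by (cases c "0::real" rule: linorder_cases) auto
    moreover have "\<exists>c. y = c *\<^sub>R x" if "line_group (u x) = line_group (u y)"
    proof -
      have polar: "v = norm v *\<^sub>R complex_to_plane (u v)" if "v \<noteq> 0" for v
      proof -
        have "plane_to_complex (norm v *\<^sub>R complex_to_plane (u v)) = plane_to_complex v"
          using that by (simp add: linear_plane_to_complex u)
        then show ?thesis
          by (metis plane_to_complex_inverse)
      qed
      have minus: "complex_to_plane (- z) = - complex_to_plane z" for z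
        by (simp add: complex_to_plane_def vec_eq_iff forall_2)
      have "complex_to_plane (u x) = inverse (norm x) *\<^sub>R x"
        using polar[OF \<open>x \<noteq> 0\<close>] \<open>x \<noteq> 0\<close>
        by (metis inverse_eq_iff_eq left_inverse norm_eq_zero scaleR_one scaleR_scaleR)
      moreover have "complex_to_plane (u y) = complex_to_plane (u x) \<or>
          complex_to_plane (u y) = - complex_to_plane (u x)"
        using that unfolding eq by (auto simp: minus)
      ultimately show ?thesis
        using polar[OF \<open>y \<noteq> 0\<close>] by (metis scaleR_minus_left scaleR_scaleR)
    qed
    ultimately show ?thesis by blast
  qed
  then have "proportional = {(x, y). x \<in> topspace (top_of_set (- {0})) \<and> y \<in> topspace (top_of_set (- {0}))
      \<and> (line_group \<circ> u) x = (line_group \<circ> u) y}"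
    unfolding proportional_def by auto
  then obtain h where "homeomorphic_map real_projective_line R_space h"
    using homeomorphic_map_from_quotient_topology[OF q] unfolding real_projective_line_def by blast
  then show ?thesis
    using homeomorphic_map_imp_homeomorphic_space homeomorphic_space_sym by blast
qed

text \<open>The cone coordinate \<open>t\<close> shrinks the parameter of a line by the factor
  \<open>1 - t\<close>. The resulting map from a compact product to a Hausdorff space is a quotient
  map, and its only identifications are the collapse at \<open>t = 1\<close>.\<close>

lemma cone_R_space:
  obtains f where "homeomorphic_map (cone_space R_space) (subtopology C_Aff disc) f"
    and "\<And>L. L \<in> R_subgroups_Aff \<Longrightarrow> f (cone_class R_space L 0) = L"
    and "\<And>L. L \<in> R_subgroups_Aff \<Longrightarrow> f (cone_class R_space L 1) = {\<one>\<^bsub>Aff\<^esub>}"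
proof -
  let ?S = "top_of_set (sphere (0::complex) 1)" and ?I = "top_of_set {0..1::real}"
  \<comment> \<open>Selects one of the two unit vectors spanning \<open>L\<close>; by
    \<open>F_line\<close> the choice of sign does not affect \<open>F\<close>.\<close>
  define dir where "dir L = (SOME w. w \<in> sphere 0 1 \<and> line_group w = L)" for L
  have dir: "dir L \<in> sphere 0 1" "line_group (dir L) = L" if "L \<in> line_group ` sphere 0 1" for L
    using that unfolding dir_def by (metis (mono_tags, lifting) imageE someI_ex)+
  define F where "F = (\<lambda>(L, t). line_group (of_real (1 - t) * dir L))"
  have F_line: "F (line_group w, t) = line_group (of_real (1 - t) * w)" if "w \<in> sphere 0 1" for w t
  proof -
    have "dir (line_group w) = w \<or> dir (line_group w) = - w"
      using dir[of "line_group w"] that line_group_eq_iff[of "dir (line_group w)" w] by auto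
    then show ?thesis
      by (auto simp: F_def line_group_def)
  qed
  have HR: "Hausdorff_space R_space"
    unfolding R_space_def by (rule Hausdorff_space_subtopology[OF Hausdorff_C_Aff])
  have cR: "compact_space R_space"
    using image_compactin[OF _ quotient_imp_continuous_map[OF quotient_map_sphere], of "sphere 0 1"]
    by (simp add: compact_space_def compactin_subtopology)
  \<comment> \<open>A quotient map by compactness, so the continuity of \<open>F\<close> can be
    checked on the circle times the interval, where no choice of direction is involved.\<close>
  define Q where "Q = (\<lambda>(w, t::real). (line_group w, t))"
  have Q: "quotient_map (prod_topology ?S ?I) (prod_topology R_space ?I) Q"
  proof (rule continuous_imp_quotient_map)
    show "continuous_map (prod_topology ?S ?I) (prod_topology R_space ?I) Q"
      unfolding Q_def continuous_map_prod_top
      using quotient_imp_continuous_map[OF quotient_map_sphere] by simp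
    show "Q ` topspace (prod_topology ?S ?I) = topspace (prod_topology R_space ?I)"
      by (force simp: Q_def)
  qed (use HR in \<open>simp_all add: compact_space_prod_topology compact_space_subtopology compact_Times
        Hausdorff_space_prod_topology Hausdorff_space_subtopology\<close>)
  have scaled: "continuous_map (prod_topology ?S ?I) (top_of_set (cball 0 1)) (\<lambda>(w, t). of_real (1 - t) * w)"
    unfolding case_prod_unfold
    by (auto simp: continuous_map_in_subtopology norm_mult simp del: of_real_diff
        simp flip: subtopology_Times euclidean_product_topology intro!: continuous_intros)
  have "continuous_map (prod_topology ?S ?I) C_Aff (line_group \<circ> (\<lambda>(w, t). of_real (1 - t) * w))"
    using scaled continuous_map_line_group by (rule continuous_map_compose)
  then have "continuous_map (prod_topology ?S ?I) C_Aff (F \<circ> Q)"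
    by (rule continuous_map_eq) (auto simp: Q_def F_line)
  then have contF: "continuous_map (prod_topology R_space ?I) C_Aff F"
    by (rule continuous_compose_quotient_map[OF Q])
  have "F ` topspace (prod_topology R_space ?I) = disc"
  proof (intro equalityI subsetI)
    fix H assume "H \<in> F ` topspace (prod_topology R_space ?I)"
    then obtain w t where "w \<in> sphere 0 1" "0 \<le> t" "t \<le> 1" "H = line_group (of_real (1 - t) * w)"
      by (auto simp: F_line)
    then show "H \<in> disc"
      by (auto simp: norm_mult simp del: of_real_diff)
  next
    fix H assume "H \<in> disc"
    then obtain w where w: "norm w \<le> 1" "H = line_group w" by auto
    obtain v where v: "norm v = 1" "w = of_real (norm w) * v"
    proof (cases "w = 0")
      case True
      then show ?thesis
        using that[of 1] by simp
    next
      case False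
      then show ?thesis
        using that[of "w / of_real (norm w)"] by (simp add: norm_divide)
    qed
    have "H = F (line_group v, 1 - norm w)"
      using v w by (simp add: F_line)
    then show "H \<in> F ` topspace (prod_topology R_space ?I)"
      using v w by (intro image_eqI) auto
  qed
  then have qF: "quotient_map (prod_topology R_space ?I) (subtopology C_Aff disc) F"
    using quotient_map_onto_image[OF contF _ Hausdorff_C_Aff] cR
    by (simp add: compact_space_prod_topology compact_space_subtopology)
  have "line_group (of_real (1 - t) * v) = line_group (of_real (1 - s) * w) \<longleftrightarrow>
      line_group v = line_group w \<and> t = s \<or> t = 1 \<and> s = 1"
    if "norm v = 1" "norm w = 1" "0 \<le> t" "t \<le> 1" "0 \<le> s" "s \<le> 1" for v w t s
  proof -
    have norms: "norm (of_real (1 - t) * v) = 1 - t" "norm (of_real (1 - s) * w) = 1 - s"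
      using that by (simp_all add: norm_mult del: of_real_diff)
    have "line_group (of_real (1 - t) * v) = line_group (of_real (1 - s) * w) \<longleftrightarrow>
        of_real (1 - t) * v = of_real (1 - s) * w \<or> of_real (1 - t) * v = - (of_real (1 - s) * w)"
      using norms that by (intro line_group_eq_iff) simp_all
    \<comment> \<open>Comparing the norms of the two parameters gives \<open>t = s\<close>.\<close>
    also have "\<dots> \<longleftrightarrow> t = s \<and> (of_real (1 - t) * v = of_real (1 - t) * w \<or> of_real (1 - t) * v = of_real (1 - t) * (- w))"
      using norms by (metis diff_left_imp_eq mult_minus_right norm_minus_cancel)
    also have "\<dots> \<longleftrightarrow> t = s \<and> (t = 1 \<or> v = w \<or> v = - w)"
      unfolding mult_cancel_left by auto
    also have "\<dots> \<longleftrightarrow> line_group v = line_group w \<and> t = s \<or> t = 1 \<and> s = 1"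
      using that line_group_eq_iff[of v w] by auto
    finally show ?thesis .
  qed
  then have ker: "F (L, t) = F (M, s) \<longleftrightarrow> L = M \<and> t = s \<or> t = 1 \<and> s = 1"
    if "L \<in> topspace R_space" "M \<in> topspace R_space" "t \<in> {0..1}" "s \<in> {0..1}" for L M t s
    using that by (auto simp: F_line simp del: of_real_diff)
  have rel: "cone_rel R_space = {(p, q). p \<in> topspace (prod_topology R_space ?I) \<and>
      q \<in> topspace (prod_topology R_space ?I) \<and> F p = F q}"
  proof -
    have "p = q \<or> snd p = 1 \<and> snd q = 1 \<longleftrightarrow> F p = F q"
      if "p \<in> topspace R_space \<times> {0..1}" "q \<in> topspace R_space \<times> {0..1}" for p q
      using that ker[of "fst p" "fst q" "snd p" "snd q"] by (simp add: prod_eq_iff mem_Times_iff)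
    then show ?thesis
      unfolding cone_rel_def topspace_prod_topology topspace_euclidean_subtopology by blast
  qed
  obtain f where f: "homeomorphic_map (cone_space R_space) (subtopology C_Aff disc) f"
    and f_class: "\<And>p. p \<in> topspace (prod_topology R_space ?I) \<Longrightarrow> f (cone_rel R_space `` {p}) = F p"
    using homeomorphic_map_from_quotient_topology[OF qF rel] unfolding cone_space_def by blast
  have "f (cone_class R_space L t) = F (L, t)" if "L \<in> R_subgroups_Aff" "t \<in> {0..1}" for L t
    using f_class[of "(L, t)"] that by (simp add: cone_class_def R_subgroups_Aff_eq)
  moreover have "F (L, 0) = L" "F (L, 1) = {\<one>\<^bsub>Aff\<^esub>}" if "L \<in> R_subgroups_Aff" for L
    using that by (auto simp: R_subgroups_Aff_eq F_line line_group_0)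
  ultimately show ?thesis
    using that f by simp
qed

section \<open>The subspace of closed normal subgroups\<close>

lemma trivial_notin_segment: "{\<one>\<^bsub>Aff\<^esub>} \<notin> segment"
proof
  assume "{\<one>\<^bsub>Aff\<^esub>} \<in> segment"
  then obtain r where r: "0 \<le> r" "r \<le> 1" "line_group 0 = full_group r"
    by (auto simp: line_group_0)
  then show False
    using line_group_eq_full_group_iff[of 0 r] by simp
qed

text \<open>The trivial subgroup and the interval are closed in \<open>C_Aff\<close> and
  complementary in \<open>N_Aff\<close>, hence each of them is open there.\<close>

lemma openin_N_Aff:
  "openin (subtopology C_Aff N_Aff) {{\<one>\<^bsub>Aff\<^esub>}}" "openin (subtopology C_Aff N_Aff) segment"
proof -
  have N: "N_Aff \<subseteq> topspace C_Aff"
    by (auto simp: N_Aff_def)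
  have "{\<one>\<^bsub>Aff\<^esub>} \<in> topspace C_Aff"
    using N N_Aff_eq by blast
  then have e: "closedin C_Aff {{\<one>\<^bsub>Aff\<^esub>}}"
    using closedin_Hausdorff_sing_eq[OF Hausdorff_C_Aff] by simp
  have "N_Aff - segment = {{\<one>\<^bsub>Aff\<^esub>}}" "N_Aff - {{\<one>\<^bsub>Aff\<^esub>}} = segment"
    unfolding N_Aff_eq using trivial_notin_segment by blast+
  then show "openin (subtopology C_Aff N_Aff) {{\<one>\<^bsub>Aff\<^esub>}}" "openin (subtopology C_Aff N_Aff) segment"
    using openin_subtopology_diff_closed[OF N] closedin_segment e by metis+
qed

lemma disconnected_N_Aff: "\<not> connected_space (subtopology C_Aff N_Aff)"
proof -
  have "topspace (subtopology C_Aff N_Aff) \<subseteq> {{\<one>\<^bsub>Aff\<^esub>}} \<union> segment"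
    unfolding N_Aff_eq by auto
  moreover have "{{\<one>\<^bsub>Aff\<^esub>}} \<inter> segment = {}" "segment \<noteq> {}" "{{\<one>\<^bsub>Aff\<^esub>}} \<noteq> {}"
    using trivial_notin_segment by auto
  ultimately show ?thesis
    unfolding connected_space_def using openin_N_Aff by blast
qed

theorem proposition1p1:
  shows "compact_space C_Aff \<and> contractible_space C_Aff \<and>
    C_Aff dim_le 2 \<and> \<not> C_Aff dim_le 1 \<and>
    (\<exists>\<D> I. closedin C_Aff \<D> \<and> closedin C_Aff I \<and> \<D> \<union> I = closed_subgroups Aff Aff_top \<and>
      (\<exists>g h.
        homeomorphic_map (top_of_set (cball (0::real^2) 1)) (subtopology C_Aff \<D>) g \<and>
        homeomorphic_map (top_of_set {0..1::real}) (subtopology C_Aff I) h \<and>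
        \<D> \<inter> I = {h 0} \<and> h 0 \<in> g ` sphere 0 1 \<and>
        g ` sphere 0 1 = R_subgroups_Aff) \<and>
      subtopology C_Aff R_subgroups_Aff homeomorphic_space real_projective_line \<and>
      (\<exists>f. homeomorphic_map (cone_space (subtopology C_Aff R_subgroups_Aff)) (subtopology C_Aff \<D>) f \<and>
        (\<forall>L\<in>R_subgroups_Aff.
          f (cone_class (subtopology C_Aff R_subgroups_Aff) L 0) = L \<and>
          f (cone_class (subtopology C_Aff R_subgroups_Aff) L 1) = {\<one>\<^bsub>Aff\<^esub>})) \<and>
      N_Aff = {{\<one>\<^bsub>Aff\<^esub>}} \<union> I \<and> {\<one>\<^bsub>Aff\<^esub>} \<notin> I \<and>
      openin (subtopology C_Aff N_Aff) {{\<one>\<^bsub>Aff\<^esub>}} \<and> openin (subtopology C_Aff N_Aff) I) \<and>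
    \<not> connected_space (subtopology C_Aff N_Aff)"
proof -
  define g where "g = (\<lambda>z. line_group (csqrt z)) \<circ> plane_to_complex"
  have g: "homeomorphic_map (top_of_set (cball 0 1)) (subtopology C_Aff disc) g"
    unfolding g_def
    using homeomorphic_map_plane_to_complex homeomorphic_map_disc by (rule homeomorphic_map_compose)
  have "(\<lambda>z. line_group (csqrt z)) ` sphere 0 1 = line_group ` sphere 0 1"
    by (rule line_group_csqrt_image) (simp add: norm_power power2_eq_1_iff, smt (verit) norm_ge_zero)
  then have g_sphere: "g ` sphere 0 1 = R_subgroups_Aff"
    unfolding g_def image_comp[symmetric] plane_to_complex_image_sphere R_subgroups_Aff_eq .
  \<comment> \<open>The attaching point lies on the boundary circle because it is the line group of
    the unit vector \<open>\<i>\<close>.\<close>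
  have h0: "full_group 0 \<in> g ` sphere 0 1"
    unfolding g_sphere full_group_0 R_subgroups_Aff_eq by simp
  obtain f where f: "homeomorphic_map (cone_space R_space) (subtopology C_Aff disc) f"
    "\<forall>L\<in>R_subgroups_Aff. f (cone_class R_space L 0) = L \<and> f (cone_class R_space L 1) = {\<one>\<^bsub>Aff\<^esub>}"
    using cone_R_space by metis
  have ex: "P disc segment \<Longrightarrow> \<exists>\<D> I. P \<D> I" for P
    by blast
  show ?thesis
  proof (intro conjI ex exI[of _ g] exI[of _ full_group] exI[of _ f])
    show "subtopology C_Aff R_subgroups_Aff homeomorphic_space real_projective_line"
      using R_space_homeomorphic_projective_line by (simp only: R_space_def)
    show "homeomorphic_map (cone_space (subtopology C_Aff R_subgroups_Aff)) (subtopology C_Aff disc) f"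
      "\<forall>L\<in>R_subgroups_Aff.
          f (cone_class (subtopology C_Aff R_subgroups_Aff) L 0) = L \<and>
          f (cone_class (subtopology C_Aff R_subgroups_Aff) L 1) = {\<one>\<^bsub>Aff\<^esub>}"
      using f by (simp_all only: R_space_def)
  qed (simp_all only: compact_C_Aff contractible_C_Aff C_Aff_dim_le_2 not_C_Aff_dim_le_1 closedin_disc
      closedin_segment closed_subgroups_Aff_eq g homeomorphic_map_segment disc_Int_segment h0[unfolded g_sphere] g_sphere
      N_Aff_eq trivial_notin_segment openin_N_Aff[unfolded N_Aff_eq] disconnected_N_Aff[unfolded N_Aff_eq]
      not_False_eq_True)
qed

end
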